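(* Each of the following sets forms a $\mathbb{Q}(\beta)$-basis of $g\Gamma$: (i) $\{ p_\lambda^{[\beta]} \}_{\lambda \in \mathcal{OP}}$; (ii) $\{ q_\lambda^{[\beta]} \}_{\lambda \in \mathcal{OP}}$; (iii) $\{ \overline{q}_\lambda^{[\beta]} \}_{\lambda \in \mathcal{OP}}$; (iv) $\{ q_\lambda^{[\beta]} \}_{\lambda \in \mathcal{SP}}$; (v) $\{ \overline{q}_\lambda^{[\beta]} \}_{\lambda \in \mathcal{SP}}$.
   Context: $\beta$ is a formal parameter, and $\overline{z} := \frac{-z}{1+\beta z}$ (expanded as a power series in $z$). $\Lambda$ is the $\mathbb{Q}(\beta)$-algebra of symmetric functions in infinitely many variables $x=(x_1,x_2,\dots)$, and $p_i=p_i(x)=\sum_j x_j^i$. An element $f\in\Lambda$ satisfies the dual $K$-$Q$-cancellation property if $f(t,-t-\beta,x_3,x_4,\dots)$ is independent of $t$. $g\Gamma\subset\Lambda$ is the subalgebra of elements satisfying the dual $K$-$Q$-cancellation property. Define $p_n^{[\beta]}(x)=\sum_{k=0}^{n-1}\binom{n}{k}(\tfrac{\beta}{2})^k p_{n-k}(x)$ for $n\ge1$; define $q_n^{[\beta]}$ by $Q^{[\beta]}(z)=\sum_{n\ge0} q_n^{[\beta]}z^n=\prod_i\frac{1-x_i\overline{z}}{1-x_iz}$; and define $\overline{q}_n^{[\beta]}$ by $\sum_{n\ge0}\overline{q}_n^{[\beta]}z^n=Q^{[\beta]}(\overline{z})$. For a partition $\lambda$, put $p_\lambda^{[\beta]}=\prod_i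 p_{\lambda_i}^{[\beta]}$, $q_\lambda^{[\beta]}=\prod_i q_{\lambda_i}^{[\beta]}$, $\overline{q}_\lambda^{[\beta]}=\prod_i \overline{q}_{\lambda_i}^{[\beta]}$ (products over the parts of $\lambda$; the empty partition gives $1$). $\mathcal{OP}$ is the set of partitions all of whose parts are odd, and $\mathcal{SP}$ the set of partitions with distinct parts (both including the empty partition). *)

theory Defs
  imports
    "HOL-Computational_Algebra.Computational_Algebra"
    "HOL-Library.Poly_Mapping"
    "HOL-Library.Groups_Big_Fun"
    "HOL-Library.Multiset"
begin

section \<open>Formal power series in infinitely many variables\<close>

text \<open>
  The variables \<open>x\<^sub>1, x\<^sub>2, \<dots>\<close> are indexed from 0: the variable \<open>x\<^sub>i\<close> of the text is
  \<open>var (i - 1)\<close>. A monomial is its finitely supported exponent vector.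
\<close>

type_synonym monom = "nat \<Rightarrow>\<^sub>0 nat"

typedef 'a mfps = "UNIV :: (monom \<Rightarrow> 'a) set"
  morphisms mcoeff Abs_mfps ..

lemma mcoeff_Abs [simp]: "mcoeff (Abs_mfps f) = f"
  by (simp add: Abs_mfps_inverse)

lemma mfps_eqI: "(\<And>m. mcoeff f m = mcoeff g m) \<Longrightarrow> f = g"
  by (metis mcoeff_inject ext)

definition splits :: "monom \<Rightarrow> (monom \<times> monom) set" where
  "splits m = {(a, b). a + b = m}"

lemma finite_splits: "finite (splits m)"
proof -
  let ?K = "Poly_Mapping.keys m"
  let ?B = "{.. Max (insert 0 (Poly_Mapping.lookup m ` ?K))}"
  let ?F = "{f. \<forall>x. (x \<in> ?K \<longrightarrow> f x \<in> ?B) \<and> (x \<notin> ?K \<longrightarrow> f x = (0::nat))}"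
  have fin: "finite ?F"
    by (rule finite_set_of_finite_funs) auto
  have bd: "Poly_Mapping.lookup a \<in> ?F" if "a + b = m" for a b
  proof -
    have le: "Poly_Mapping.lookup a x \<le> Poly_Mapping.lookup m x" for x
      using that by (auto simp: lookup_add)
    show ?thesis
    proof (intro CollectI allI conjI impI)
      fix x assume "x \<in> ?K"
      then have "Poly_Mapping.lookup m x \<le> Max (insert 0 (Poly_Mapping.lookup m ` ?K))"
        by (intro Max_ge) auto
      then show "Poly_Mapping.lookup a x \<in> ?B"
        using le[of x] by auto
    next
      fix x assume "x \<notin> ?K"
      then have "Poly_Mapping.lookup m x = 0"
        by (simp add: in_keys_iff)
      then show "Poly_Mapping.lookup a x = 0"
        using le[of x] by simp
    qed
  qed
  have "inj_on (\<lambda>(a, b). (Poly_Mapping.lookup a, Poly_Mapping.lookup b)) (splits m)"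
    by (auto simp: inj_on_def lookup_inject)
  moreover have "(\<lambda>(a, b). (Poly_Mapping.lookup a, Poly_Mapping.lookup b)) ` splits m \<subseteq> ?F \<times> ?F"
  proof (rule image_subsetI)
    fix p assume "p \<in> splits m"
    then have p: "fst p + snd p = m" "snd p + fst p = m"
      by (auto simp: splits_def add.commute)
    show "(case p of (a, b) \<Rightarrow> (Poly_Mapping.lookup a, Poly_Mapping.lookup b)) \<in> ?F \<times> ?F"
      unfolding case_prod_unfold by (rule SigmaI[OF bd[OF p(1)] bd[OF p(2)]])
  qed
  ultimately show ?thesis
    using fin by (meson finite_SigmaI finite_imageD finite_subset)
qed

instantiation mfps :: (comm_ring_1) comm_ring_1
begin

definition zero_mfps :: "'a mfps" where
  "0 = Abs_mfps (\<lambda>_. 0)"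
definition one_mfps :: "'a mfps" where
  "1 = Abs_mfps (\<lambda>m. if m = 0 then 1 else 0)"
definition plus_mfps :: "'a mfps \<Rightarrow> 'a mfps \<Rightarrow> 'a mfps" where
  "f + g = Abs_mfps (\<lambda>m. mcoeff f m + mcoeff g m)"
definition minus_mfps :: "'a mfps \<Rightarrow> 'a mfps \<Rightarrow> 'a mfps" where
  "f - g = Abs_mfps (\<lambda>m. mcoeff f m - mcoeff g m)"
definition uminus_mfps :: "'a mfps \<Rightarrow> 'a mfps" where
  "- f = Abs_mfps (\<lambda>m. - mcoeff f m)"
definition times_mfps :: "'a mfps \<Rightarrow> 'a mfps \<Rightarrow> 'a mfps" where
  "f * g = Abs_mfps (\<lambda>m. \<Sum>(a, b) | a + b = m. mcoeff f a * mcoeff g b)"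

instance
proof
  fix f g h :: "'a mfps"
  have times: "mcoeff (f * g) m = (\<Sum>(a, b)\<in>splits m. mcoeff f a * mcoeff g b)"
    for f g :: "'a mfps" and m
    by (simp add: times_mfps_def splits_def)
  show "f * g * h = f * (g * h)"
  proof (rule mfps_eqI)
    fix m
    have "mcoeff (f * g * h) m =
      (\<Sum>(c, d)\<in>splits m. \<Sum>(a, b)\<in>splits c. mcoeff f a * mcoeff g b * mcoeff h d)"
      by (simp add: times sum_distrib_right case_prod_unfold)
    also have "\<dots> = (\<Sum>(p, q)\<in>(SIGMA p:splits m. splits (fst p)).
        mcoeff f (fst q) * mcoeff g (snd q) * mcoeff h (snd p))"
      by (simp add: sum.Sigma finite_splits case_prod_unfold)
    also have "\<dots> = (\<Sum>(p, q)\<in>(SIGMA p:splits m. splits (snd p)).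
        mcoeff f (fst p) * mcoeff g (fst q) * mcoeff h (snd q))"
      by (rule sum.reindex_bij_witness[where
            i = "\<lambda>((a, e), (b, d)). ((a + b, d), (a, b))" and
            j = "\<lambda>((c, d), (a, b)). ((a, b + d), (b, d))"])
        (auto simp: splits_def add.assoc)
    also have "\<dots> = (\<Sum>(a, e)\<in>splits m. \<Sum>(b, d)\<in>splits e. mcoeff f a * mcoeff g b * mcoeff h d)"
      by (simp add: sum.Sigma finite_splits case_prod_unfold)
    also have "\<dots> = mcoeff (f * (g * h)) m"
      by (simp add: times sum_distrib_left case_prod_unfold mult.assoc)
    finally show "mcoeff (f * g * h) m = mcoeff (f * (g * h)) m" .
  qed
  show "f * g = g * f"
  proof (rule mfps_eqI)
    fix m
    show "mcoeff (f * g) m = mcoeff (g * f) m"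
      unfolding times
      by (rule sum.reindex_bij_witness[where i = prod.swap and j = prod.swap])
        (auto simp: splits_def add.commute mult.commute)
  qed
  show "1 * f = f"
  proof (rule mfps_eqI)
    fix m
    have "mcoeff (1 * f) m = (\<Sum>p\<in>splits m. if p = (0, m) then mcoeff f m else 0)"
      unfolding times
      by (rule sum.cong) (auto simp: one_mfps_def splits_def split: if_splits)
    also have "\<dots> = mcoeff f m"
      by (subst sum.delta[OF finite_splits]) (simp add: splits_def)
    finally show "mcoeff (1 * f) m = mcoeff f m" .
  qed
  show "(f + g) * h = f * h + g * h"
    by (rule mfps_eqI)
      (simp add: times plus_mfps_def case_prod_unfold distrib_right sum.distrib)
  show "(0::'a mfps) \<noteq> 1"
  proof
    assume "(0::'a mfps) = 1"
    then have "mcoeff (0::'a mfps) 0 = mcoeff 1 0"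
      by simp
    then show False
      by (simp add: zero_mfps_def one_mfps_def)
  qed
qed (rule mfps_eqI, simp add: plus_mfps_def minus_mfps_def uminus_mfps_def zero_mfps_def ac_simps)+

end

definition var :: "nat \<Rightarrow> 'a::comm_ring_1 mfps" where
  "var i = Abs_mfps (\<lambda>m. if m = Poly_Mapping.single i 1 then 1 else 0)"

definition mscale :: "'a \<Rightarrow> 'a mfps \<Rightarrow> 'a::comm_ring_1 mfps" where
  "mscale c f = Abs_mfps (\<lambda>m. c * mcoeff f m)"

global_interpretation mfps: vector_space "mscale :: 'a::field \<Rightarrow> 'a mfps \<Rightarrow> 'a mfps"
  by unfold_locales
    (rule mfps_eqI, simp add: mscale_def plus_mfps_def distrib_left distrib_right mult.assoc)+

text \<open>
  Coefficientwise limit of a sequence of series, each coefficient being eventually constant.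
  Infinite sums and products over the variables are limits of their partial sums and products
  in this sense.
\<close>

definition mlim :: "(nat \<Rightarrow> 'a mfps) \<Rightarrow> 'a mfps" where
  "mlim F = Abs_mfps (\<lambda>m. THE c. \<forall>\<^sub>F N in sequentially. mcoeff (F N) m = c)"

lemma mcoeff_mlim:
  assumes "\<And>N. N \<ge> N0 \<Longrightarrow> mcoeff (F N) m = c"
  shows "mcoeff (mlim F) m = c"
proof -
  have c: "\<forall>\<^sub>F N in sequentially. mcoeff (F N) m = c"
    using assms by (auto simp: eventually_sequentially)
  have "d = c" if "\<forall>\<^sub>F N in sequentially. mcoeff (F N) m = d" for d
    using eventually_happens'[OF sequentially_bot eventually_conj[OF c that]] by blast
  with c show ?thesis
    unfolding mlim_def mcoeff_Abs by (rule the_equality)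
qed

section \<open>Symmetric functions and the cancellation property\<close>

type_synonym qbeta = "rat poly fract"

definition beta :: qbeta (\<open>\<beta>\<close>) where
  "\<beta> = Fract [:0, 1:] 1"

definition total_degree :: "monom \<Rightarrow> nat" where
  "total_degree m = (\<Sum>i\<in>Poly_Mapping.keys m. Poly_Mapping.lookup m i)"

definition bounded_degree :: "'a::zero mfps \<Rightarrow> bool" where
  "bounded_degree f \<longleftrightarrow> (\<exists>d. \<forall>m. mcoeff f m \<noteq> 0 \<longrightarrow> total_degree m \<le> d)"

definition symmetric :: "'a mfps \<Rightarrow> bool" where
  "symmetric f \<longleftrightarrow>
     (\<forall>\<pi>. bij \<pi> \<longrightarrow> (\<forall>m. mcoeff f (Poly_Mapping.map_key \<pi> m) = mcoeff f m))"

definition Lambda :: "qbeta mfps set" (\<open>\<Lambda>\<close>) where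
  "\<Lambda> = {f. symmetric f \<and> bounded_degree f}"

text \<open>
  The series \<open>f(t, - t - \<beta>, x\<^sub>3, x\<^sub>4, \<dots>)\<close>, with coefficients in the polynomial ring in \<open>t\<close>.
  The variables \<open>x\<^sub>3, x\<^sub>4, \<dots>\<close> keep their indices, so the first two do not occur in the result.
  The sum is finite because \<open>f\<close> has bounded degree.
\<close>

definition dual_subst :: "qbeta mfps \<Rightarrow> qbeta poly mfps" where
  "dual_subst f = Abs_mfps (\<lambda>m.
     if Poly_Mapping.lookup m 0 = 0 \<and> Poly_Mapping.lookup m 1 = 0
     then \<Sum>(i, j). smult (mcoeff f (Poly_Mapping.single 0 i + Poly_Mapping.single 1 j + m))
                          ([:0, 1:] ^ i * [:- \<beta>, - 1:] ^ j)
     else 0)"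

lemma finite_dual_subst:
  assumes "bounded_degree f"
  shows "finite {(i, j). smult (mcoeff f (Poly_Mapping.single 0 i + Poly_Mapping.single 1 j + m))
                          ([:0, 1:] ^ i * [:- \<beta>, - 1:] ^ j) \<noteq> 0}"
proof -
  obtain d where d: "\<And>m. mcoeff f m \<noteq> 0 \<Longrightarrow> total_degree m \<le> d"
    using assms by (auto simp: bounded_degree_def)
  have le: "Poly_Mapping.lookup m' k \<le> total_degree m'" for m' :: monom and k
  proof (cases "k \<in> Poly_Mapping.keys m'")
    case True
    then show ?thesis
      unfolding total_degree_def by (intro member_le_sum) auto
  qed (simp add: in_keys_iff)
  have "i \<le> d \<and> j \<le> d"
    if "mcoeff f (Poly_Mapping.single 0 i + Poly_Mapping.single 1 j + m) \<noteq> 0" for i j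
    using order_trans[OF le d[OF that], of 0] order_trans[OF le d[OF that], of 1]
    by (simp add: lookup_add lookup_single)
  then have "{(i, j). smult (mcoeff f (Poly_Mapping.single 0 i + Poly_Mapping.single 1 j + m))
                          ([:0, 1:] ^ i * [:- \<beta>, - 1:] ^ j) \<noteq> 0} \<subseteq> {..d} \<times> {..d}"
    by auto
  then show ?thesis
    by (rule finite_subset) auto
qed

definition dual_KQ_cancellation :: "qbeta mfps \<Rightarrow> bool" where
  "dual_KQ_cancellation f \<longleftrightarrow> (\<forall>m. degree (mcoeff (dual_subst f) m) = 0)"

definition gGamma :: "qbeta mfps set" (\<open>g\<Gamma>\<close>) where
  "g\<Gamma> = {f \<in> \<Lambda>. dual_KQ_cancellation f}"

section \<open>The three families of generators\<close>

definition power_sum :: "nat \<Rightarrow> qbeta mfps" where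
  "power_sum k = mlim (\<lambda>N. \<Sum>j<N. var j ^ k)"

definition p_beta :: "nat \<Rightarrow> qbeta mfps" where
  "p_beta n = (\<Sum>k<n. mscale (of_nat (n choose k) * (\<beta> / 2) ^ k) (power_sum (n - k)))"

text \<open>
  \<open>z\<close> is \<open>fps_X\<close>, and \<open>zbar = - z / (1 + \<beta> z)\<close>. As the coefficients form only a ring, inverses of
  power series with constant term 1 are taken with \<open>fps_right_inverse\<close>.
\<close>

definition zbar :: "qbeta mfps fps" where
  "zbar = - fps_X * fps_right_inverse (1 + fps_const (mscale \<beta> 1) * fps_X) 1"

definition Q_factor :: "nat \<Rightarrow> qbeta mfps fps" where
  "Q_factor i = (1 - fps_const (var i) * zbar) * fps_right_inverse (1 - fps_const (var i) * fps_X) 1"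

definition Q_beta :: "qbeta mfps fps" where
  "Q_beta = Abs_fps (\<lambda>n. mlim (\<lambda>N. fps_nth (\<Prod>i<N. Q_factor i) n))"

definition q_beta :: "nat \<Rightarrow> qbeta mfps" where
  "q_beta n = fps_nth Q_beta n"

definition qbar_beta :: "nat \<Rightarrow> qbeta mfps" where
  "qbar_beta n = fps_nth (fps_compose Q_beta zbar) n"

text \<open>
  The two limits exist: a term or factor involving \<open>var N\<close> does not affect the coefficient of a
  monomial in which \<open>var N\<close> does not occur.
\<close>

lemma mcoeff_var_times:
  assumes "Poly_Mapping.lookup m N = 0"
  shows "mcoeff (var N * g) m = 0"
proof -
  have "mcoeff (var N :: 'a mfps) a * mcoeff g b = 0" if "a + b = m" for a b
    using that assms by (auto simp: var_def lookup_add lookup_single)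
  then show ?thesis
    by (auto simp: times_mfps_def intro!: sum.neutral)
qed

lemma mcoeff_add: "mcoeff (f + g) m = mcoeff f m + mcoeff g m"
  by (simp add: plus_mfps_def)

lemma mcoeff_stable:
  assumes "\<And>N. Poly_Mapping.lookup m N = 0 \<Longrightarrow> mcoeff (F (Suc N)) m = mcoeff (F N) m"
  shows "\<exists>c. \<forall>\<^sub>F N in sequentially. mcoeff (F N) m = c"
proof -
  obtain N0 where N0: "\<And>N. N \<ge> N0 \<Longrightarrow> Poly_Mapping.lookup m N = 0"
  proof
    fix N assume N: "N \<ge> Suc (Max (insert 0 (Poly_Mapping.keys m)))"
    have "N \<notin> Poly_Mapping.keys m"
    proof
      assume "N \<in> Poly_Mapping.keys m"
      then have "N \<le> Max (insert 0 (Poly_Mapping.keys m))"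
        by (intro Max_ge) auto
      with N show False by simp
    qed
    then show "Poly_Mapping.lookup m N = 0"
      by (simp add: in_keys_iff)
  qed
  have "mcoeff (F N) m = mcoeff (F N0) m" if "N \<ge> N0" for N
    using that by (induction N rule: dec_induct) (auto simp: assms N0)
  then show ?thesis
    by (auto simp: eventually_sequentially)
qed

lemma power_sum_limit_exists:
  assumes "k \<ge> 1"
  shows "\<exists>c. \<forall>\<^sub>F N in sequentially. mcoeff (\<Sum>j<N. var j ^ k :: qbeta mfps) m = c"
proof (rule mcoeff_stable)
  fix N assume "Poly_Mapping.lookup m N = 0"
  moreover obtain l where "k = Suc l"
    using assms by (cases k) auto
  ultimately show "mcoeff (\<Sum>j<Suc N. var j ^ k :: qbeta mfps) m = mcoeff (\<Sum>j<N. var j ^ k) m"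
    by (simp add: mcoeff_add mcoeff_var_times)
qed

lemma Q_beta_limit_exists:
  "\<exists>c. \<forall>\<^sub>F N in sequentially. mcoeff (fps_nth (\<Prod>i<N. Q_factor i) n) m = c"
proof (rule mcoeff_stable)
  fix N assume m: "Poly_Mapping.lookup m N = 0"
  define r where "r = fps_right_inverse (1 - fps_const (var N :: qbeta mfps) * fps_X) 1"
  have inv: "(1 - fps_const (var N) * fps_X) * r = 1"
    unfolding r_def by (rule fps_right_inverse) simp
  have "1 - fps_const (var N) * zbar = (1 - fps_const (var N) * fps_X) + fps_const (var N) * (fps_X - zbar)"
    by (simp only: right_diff_distrib) simp
  then have "Q_factor N = (1 - fps_const (var N) * fps_X) * r + fps_const (var N) * ((fps_X - zbar) * r)"
    by (simp only: Q_factor_def r_def distrib_right mult.assoc)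
  then have Q: "Q_factor N = 1 + fps_const (var N) * ((fps_X - zbar) * r)"
    by (simp add: inv)
  have "(\<Prod>i<Suc N. Q_factor i) =
        (\<Prod>i<N. Q_factor i) + fps_const (var N) * ((\<Prod>i<N. Q_factor i) * ((fps_X - zbar) * r))"
    by (simp add: Q distrib_left mult.left_commute)
  then show "mcoeff (fps_nth (\<Prod>i<Suc N. Q_factor i) n) m
           = mcoeff (fps_nth (\<Prod>i<N. Q_factor i) n) m"
    by (simp only: fps_add_nth fps_mult_left_const_nth mcoeff_add mcoeff_var_times[OF m] add_0_right)
qed

lemma zbar_equation: "(1 + fps_const (mscale \<beta> 1) * fps_X) * zbar = - fps_X"
proof -
  have "(1 + fps_const (mscale \<beta> 1) * fps_X) *
        fps_right_inverse (1 + fps_const (mscale \<beta> 1) * fps_X) 1 = (1 :: qbeta mfps fps)"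
    by (rule fps_right_inverse) simp
  then show ?thesis
    unfolding zbar_def by (subst mult.left_commute) simp
qed

section \<open>Partitions and bases\<close>

definition partitions :: "nat multiset set" where
  "partitions = {\<mu>. 0 \<notin># \<mu>}"

definition odd_partitions :: "nat multiset set" (\<open>\<O>\<P>\<close>) where
  "\<O>\<P> = {\<mu> \<in> partitions. \<forall>i \<in># \<mu>. odd i}"

definition strict_partitions :: "nat multiset set" (\<open>\<S>\<P>\<close>) where
  "\<S>\<P> = {\<mu> \<in> partitions. \<forall>i \<in># \<mu>. count \<mu> i = 1}"

definition prod_parts :: "(nat \<Rightarrow> 'a::comm_ring_1 mfps) \<Rightarrow> nat multiset \<Rightarrow> 'a mfps" where
  "prod_parts f \<mu> = (\<Prod>i\<in>#\<mu>. f i)"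

text \<open>Basis as an indexed family: distinct indices give distinct basis vectors.\<close>

definition is_basis_family :: "('i \<Rightarrow> 'a::field mfps) \<Rightarrow> 'i set \<Rightarrow> 'a mfps set \<Rightarrow> bool" where
  "is_basis_family b I V \<longleftrightarrow>
     inj_on b I \<and> mfps.independent (b ` I) \<and> mfps.span (b ` I) = V"

end

theory Submission
  imports Defs "HOL-Combinatorics.Permutations" "HOL-Library.Nat_Bijection"
begin

text \<open>
  Order monomials by number of variables, then by degree. The leading monomial of a product
  \<open>p\<^sub>\<lambda>\<close> of the deformed power sums is \<open>x\<^sup>\<lambda>\<close>. If \<open>f\<close> has the cancellation property and
  \<open>x\<^sup>\<mu>\<close> is a leading monomial of \<open>f\<close> with a part \<open>k\<close>, then the coefficient of \<open>t\<^sup>k\<close> in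
  \<open>f(t, -t-\<beta>, x\<^sub>3, \<dots>)\<close> at the remaining variables is \<open>1 + (-1)\<^sup>k\<close> times the leading coefficient, so all
  parts of \<open>\<mu>\<close> are odd. Subtracting leading terms therefore expands \<open>f\<close> in the \<open>p\<^sub>\<lambda>\<close> with odd parts.

  The logarithmic derivative of \<open>Q(z)\<close> gives Newton identities which show that \<open>q\<^sub>n\<close> and
  \<open>(-1)\<^sup>n\<close> times its conjugate agree, up to terms of smaller size, with the polynomial that expresses the
  classical \<open>q\<^sub>n\<close> in odd power sums. For any such sequence the classical relations
  \<open>\<Sum>\<^sub>i (-1)\<^sup>i q\<^sub>i q\<^bsub>n-i\<^esub> = 0\<close> and the Newton identities, used modulo smaller sizes, show that the products
  over odd and over strict partitions span the same filtration; there are at most as many strict as odd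
  partitions of each size, so both families are bases.
\<close>

text \<open>The number of variables ranks above the degree because of the substitution: with the
  degree first, every \<open>x_1^i x_2^j\<close> with \<open>i + j = k\<close> would contribute to
  the coefficient of \<open>t^k\<close>. A bound on the number of variables excludes
  \<open>i, j > 0\<close>, and the degree then excludes higher powers of one variable. The same
  order discards the monomials of a product of power sums in which two factors pick the same
  variable. The constant \<beta>/2 centres \<open>t -> -t - \<beta>\<close> at its fixed point:
  \<open>u = t + \<beta>/2\<close> changes sign, and \<open>p_beta n\<close> is the sum of
  \<open>(x_i + \<beta>/2)^n - (\<beta>/2)^n\<close>. The same shift makes the logarithmic
  derivative of each factor of Q(z) odd in \<open>x_i + \<beta>/2\<close>, so only odd power sums
  enter. As \<beta> destroys homogeneity, a filtration replaces the grading. Its levels are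
  finite-dimensional, so a spanning family with at most as many members as the dimension is
  independent; this is where the count of strict against odd partitions enters. Characteristic 0
  keeps positive integer leading coefficients nonzero and permits division by \<open>n\<close> in
  the Newton identities.\<close>

instance fract :: ("{idom, ring_char_0}") field_char_0
proof
  show "inj (of_nat :: nat \<Rightarrow> 'a fract)"
    by (rule injI) (simp add: of_nat_fract eq_fract)
qed

abbreviation lookup :: "monom \<Rightarrow> nat \<Rightarrow> nat" where "lookup \<equiv> Poly_Mapping.lookup"
abbreviation keys :: "monom \<Rightarrow> nat set" where "keys \<equiv> Poly_Mapping.keys"
abbreviation single :: "nat \<Rightarrow> nat \<Rightarrow> monom" where "single \<equiv> Poly_Mapping.single"

section \<open>Coefficients\<close>

lemma mcoeff_0 [simp]: "mcoeff 0 m = 0"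
  by (simp add: zero_mfps_def)

lemma mcoeff_1: "mcoeff 1 m = (if m = 0 then 1 else 0)"
  by (simp add: one_mfps_def)

lemma mcoeff_diff: "mcoeff (f - g) m = mcoeff f m - mcoeff g m"
  by (simp add: minus_mfps_def)

lemma mcoeff_uminus: "mcoeff (- f) m = - mcoeff f m"
  by (simp add: uminus_mfps_def)

lemma mcoeff_mscale: "mcoeff (mscale c f) m = c * mcoeff f m"
  by (simp add: mscale_def)

lemma mcoeff_mult: "mcoeff (f * g) m = (\<Sum>(a, b)\<in>splits m. mcoeff f a * mcoeff g b)"
  by (simp add: times_mfps_def splits_def)

lemma mcoeff_sum: "mcoeff (\<Sum>i\<in>A. f i) m = (\<Sum>i\<in>A. mcoeff (f i) m)"
  by (induction A rule: infinite_finite_induct) (auto simp: mcoeff_add)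

lemma mscale_mult_left: "mscale c f * g = mscale c (f * g)"
  by (rule mfps_eqI) (auto simp: mcoeff_mult mcoeff_mscale sum_distrib_left mult.assoc intro!: sum.cong)

lemma mscale_mult_right: "f * mscale c g = mscale c (f * g)"
  by (simp only: mult.commute[of f] mscale_mult_left)

lemma mscale_conv_mult: "mscale c f = mscale c 1 * f"
  by (simp add: mscale_mult_left)

lemma mscale_of_nat: "mscale (of_nat n) f = of_nat n * f"
proof -
  have "mscale (of_nat n) 1 = (of_nat n :: 'a mfps)"
  proof (induction n)
    case (Suc n)
    have "mscale (of_nat (Suc n)) 1 = (1 :: 'a mfps) + mscale (of_nat n) 1"
      by (rule mfps_eqI) (simp add: mcoeff_mscale mcoeff_add distrib_right)
    then show ?case by (simp add: Suc)
  qed (auto intro!: mfps_eqI simp: mcoeff_mscale)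
  then show ?thesis
    by (simp add: mscale_conv_mult[of _ f])
qed

lemma mscale_one_mult: "mscale c 1 * mscale d 1 = mscale (c * d) 1"
  by (rule mfps_eqI) (simp add: mscale_mult_left mcoeff_mscale mult.assoc)

lemma mscale_one_power: "mscale c 1 ^ n = mscale (c ^ n) 1"
  by (induction n) (auto intro!: mfps_eqI simp: mcoeff_mscale mscale_one_mult)

lemma splits_iff: "(a, b) \<in> splits m \<longleftrightarrow> a + b = m"
  by (simp add: splits_def)

section \<open>Exponent multisets of monomials\<close>

text \<open>The orbit invariant of a monomial under permutations of the variables; the coefficients
  of a symmetric series depend on it alone.\<close>

definition shape :: "monom \<Rightarrow> nat multiset" where
  "shape m = image_mset (lookup m) (mset_set (keys m))"

lemma size_shape: "size (shape m) = card (keys m)"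
  by (simp add: shape_def)

lemma sum_mset_shape: "\<Sum>\<^sub># (shape m) = total_degree m"
  by (simp add: shape_def total_degree_def sum_unfold_sum_mset)

lemma set_mset_shape: "set_mset (shape m) = lookup m ` keys m"
  by (simp add: shape_def)

lemma shape_in_partitions: "shape m \<in> partitions"
  by (auto simp: partitions_def set_mset_shape in_keys_iff)

lemma keys_add: "keys (a + b) = keys a \<union> keys b"
  by (auto simp: in_keys_iff lookup_add)

lemma total_degree_superset:
  assumes "finite A" "keys m \<subseteq> A"
  shows "total_degree m = (\<Sum>i\<in>A. lookup m i)"
  unfolding total_degree_def
  by (rule sum.mono_neutral_left) (use assms in \<open>auto simp: in_keys_iff\<close>)

lemma total_degree_add: "total_degree (a + b) = total_degree a + total_degree b"
proof -
  have "total_degree x = (\<Sum>i\<in>keys a \<union> keys b. lookup x i)"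
    if "keys x \<subseteq> keys a \<union> keys b" for x
    using that by (intro total_degree_superset) auto
  from this[of a] this[of b] this[of "a + b"] show ?thesis
    by (simp add: keys_add lookup_add sum.distrib)
qed

lemma card_keys_add_le: "card (keys (a + b)) \<le> card (keys a) + card (keys b)"
  by (simp add: keys_add card_Un_le)

lemma card_keys_le_total_degree: "card (keys m) \<le> total_degree m"
proof -
  have "card (keys m) = (\<Sum>i\<in>keys m. 1)" by simp
  also have "\<dots> \<le> total_degree m"
    unfolding total_degree_def by (rule sum_mono) (auto simp: in_keys_iff)
  finally show ?thesis .
qed

lemma shape_add_disjoint:
  assumes "keys a \<inter> keys b = {}"
  shows "shape (a + b) = shape a + shape b"
proof -
  have "image_mset (lookup (a + b)) (mset_set (keys a)) = shape a"
    unfolding shape_def by (rule image_mset_cong) (use assms in \<open>auto simp: lookup_add in_keys_iff\<close>)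
  moreover have "image_mset (lookup (a + b)) (mset_set (keys b)) = shape b"
    unfolding shape_def by (rule image_mset_cong) (use assms in \<open>auto simp: lookup_add in_keys_iff\<close>)
  ultimately show ?thesis
    using assms by (simp add: shape_def[of "a + b"] keys_add mset_set_Union)
qed

lemma shape_single: "k \<noteq> 0 \<Longrightarrow> shape (single i k) = {#k#}"
  by (simp add: shape_def)

lemma total_degree_single: "total_degree (single i k) = k"
  by (cases "k = 0") (auto simp: total_degree_def)

lemma total_degree_eq_0: "total_degree m = 0 \<longleftrightarrow> m = 0"
proof
  assume "total_degree m = 0"
  then have "card (keys m) = 0"
    using card_keys_le_total_degree[of m] by simp
  then show "m = 0" by simp
qed (simp add: total_degree_def)

lemma lookup_map_key: "bij \<pi> \<Longrightarrow> lookup (Poly_Mapping.map_key \<pi> m) i = lookup m (\<pi> i)"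
  by (simp add: Poly_Mapping.map_key.rep_eq bij_is_inj)

lemma shape_map_key:
  assumes "bij \<pi>"
  shows "shape (Poly_Mapping.map_key \<pi> m) = shape m"
proof -
  have inj: "inj \<pi>" using assms by (rule bij_is_inj)
  have k: "keys m = \<pi> ` keys (Poly_Mapping.map_key \<pi> m)"
    using bij_is_surj[OF assms] by (simp add: keys_map_key[OF inj] surj_image_vimage_eq)
  have "mset_set (keys m) = image_mset \<pi> (mset_set (keys (Poly_Mapping.map_key \<pi> m)))"
    unfolding k by (rule image_mset_mset_set[symmetric]) (use inj inj_on_subset in blast)
  moreover have "lookup (Poly_Mapping.map_key \<pi> m) = lookup m \<circ> \<pi>"
    by (rule ext) (simp add: lookup_map_key assms)
  ultimately show ?thesis
    by (simp add: shape_def image_mset.compositionality)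
qed

lemma shape_eqE:
  assumes "shape a = shape b"
  obtains \<pi> where "bij \<pi>" "Poly_Mapping.map_key \<pi> b = a"
proof -
  let ?A = "keys a \<union> keys b"
  \<comment> \<open>Over a common finite index set the exponents are the parts padded with zeros.
    Equally many parts mean equal padding, so a permutation of this set matches the
    exponents.\<close>
  have *: "image_mset (lookup x) (mset_set ?A) = shape x + replicate_mset (card ?A - card (keys x)) 0"
    if "keys x \<subseteq> ?A" for x
  proof -
    have "mset_set ?A = mset_set (keys x) + mset_set (?A - keys x)"
      using that by (subst mset_set_Union[symmetric]) (auto simp: Un_absorb1)
    moreover have "image_mset (lookup x) (mset_set (?A - keys x)) = image_mset (\<lambda>_. 0) (mset_set (?A - keys x))"
      by (rule image_mset_cong) (auto simp: in_keys_iff)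
    moreover have "card (?A - keys x) = card ?A - card (keys x)"
      using that by (simp add: card_Diff_subset)
    ultimately show ?thesis
      by (simp add: shape_def image_mset_const_eq)
  qed
  have "card (keys a) = card (keys b)"
    using assms by (metis size_shape)
  then have eq: "image_mset (lookup a) (mset_set ?A) = image_mset (lookup b) (mset_set ?A)"
    by (simp only: *[OF Un_upper1] *[OF Un_upper2] assms)
  have "finite ?A" by simp
  then obtain p where p: "p permutes ?A" "\<forall>x\<in>?A. lookup a x = lookup b (p x)"
    using eq
    by (rule image_mset_eq_implies_permutes)
  have b: "bij p" using p(1) by (rule permutes_bij)
  have "Poly_Mapping.map_key p b = a"
  proof (rule poly_mapping_eqI)
    fix x
    show "lookup (Poly_Mapping.map_key p b) x = lookup a x"
    proof (cases "x \<in> ?A")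
      case False
      then show ?thesis
        using permutes_not_in[OF p(1) False] by (simp add: lookup_map_key[OF b] in_keys_iff)
    qed (use p(2) in \<open>simp add: lookup_map_key[OF b]\<close>)
  qed
  with b show ?thesis by (rule that)
qed

lemma ex_shape_avoiding:
  assumes "\<mu> \<in> partitions" "finite A"
  obtains m where "shape m = \<mu>" "keys m \<inter> A = {}"
proof -
  have "\<exists>m. shape m = \<mu> \<and> keys m \<inter> A = {}" using assms(1)
  proof (induction \<mu>)
    case empty
    then show ?case by (intro exI[of _ 0]) (simp add: shape_def)
  next
    case (add k \<mu>)
    then obtain m where m: "shape m = \<mu>" "keys m \<inter> A = {}" by (auto simp: partitions_def)
    obtain i where i: "i \<notin> keys m \<union> A"
      using ex_new_if_finite[OF infinite_UNIV_nat, of "keys m \<union> A"] assms(2) by auto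
    have k: "k \<noteq> 0" using add.prems by (auto simp: partitions_def)
    have "shape (single i k + m) = add_mset k \<mu>"
      by (subst shape_add_disjoint) (use i k m in \<open>auto simp: shape_single\<close>)
    moreover have "keys (single i k + m) \<inter> A = {}"
      using i m k by (auto simp: keys_add)
    ultimately show ?case by blast
  qed
  with that show ?thesis by blast
qed

lemma symmetric_mcoeff_eq:
  assumes "symmetric f" "shape a = shape b"
  shows "mcoeff f a = mcoeff f b"
  by (rule shape_eqE[OF assms(2)]) (use assms(1) in \<open>auto simp: symmetric_def\<close>)

lemma symmetricI:
  assumes "\<And>a b. shape a = shape b \<Longrightarrow> mcoeff f a = mcoeff f b"
  shows "symmetric f"
  unfolding symmetric_def by (intro allI impI assms shape_map_key)

section \<open>Leading monomials of products of power sums\<close>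

lemma mcoeff_var: "mcoeff (var i) m = (if m = single i 1 then 1 else 0)"
  by (simp add: var_def)

lemma mcoeff_var_power: "mcoeff (var i ^ k) m = (if m = single i k then 1 else 0)"
proof (induction k arbitrary: m)
  case 0
  then show ?case by (simp add: mcoeff_1)
next
  case (Suc k)
  have "mcoeff (var i ^ Suc k) m =
      (\<Sum>(a, b)\<in>splits m. if (a, b) = (single i 1, single i k) then 1 else 0 :: 'a)"
    unfolding power_Suc mcoeff_mult by (rule sum.cong) (auto simp: Suc mcoeff_var split: if_splits)
  also have "\<dots> = (\<Sum>p\<in>splits m. if p = (single i 1, single i k) then 1 else 0)"
    by (simp add: case_prod_unfold prod_eq_iff)
  also have "\<dots> = (if (single i 1, single i k) \<in> splits m then 1 else 0)"
    by (simp add: finite_splits)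
  also have "(single i 1, single i k) \<in> splits m \<longleftrightarrow> m = single i (Suc k)"
    by (auto simp: splits_iff single_add[symmetric])
  finally show ?case .
qed

lemma single_eq_single_iff: "k \<noteq> 0 \<Longrightarrow> single i k = single j l \<longleftrightarrow> i = j \<and> k = l"
  by (metis lookup_single_eq lookup_single_not_eq)

lemma mcoeff_power_sum:
  assumes "k \<ge> 1"
  shows "mcoeff (power_sum k) m = (if \<exists>i. m = single i k then 1 else 0)"
proof (cases "\<exists>i. m = single i k")
  case True
  then obtain i where i: "m = single i k" by blast
  have "mcoeff (\<Sum>j<N. var j ^ k) m = (1 :: qbeta)" if "N \<ge> Suc i" for N
  proof -
    have "mcoeff (\<Sum>j<N. var j ^ k :: qbeta mfps) m = (\<Sum>j<N. if j = i then 1 else 0)"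
      unfolding mcoeff_sum mcoeff_var_power
      by (rule sum.cong) (use assms i single_eq_single_iff[of k i] in auto)
    also have "\<dots> = 1" using that by simp
    finally show ?thesis .
  qed
  then show ?thesis
    using i unfolding power_sum_def by (subst mcoeff_mlim[where ?N0.0 = "Suc i" and c = 1]) auto
next
  case False
  then have "mcoeff (\<Sum>j<N. var j ^ k :: qbeta mfps) m = 0" for N
    by (auto simp: mcoeff_sum mcoeff_var_power intro!: sum.neutral)
  then show ?thesis
    using False unfolding power_sum_def by (subst mcoeff_mlim[where c = 0]) auto
qed

lemma mcoeff_p_beta:
  "mcoeff (p_beta n) m =
     (\<Sum>j=1..n. if \<exists>i. m = single i j then of_nat (n choose j) * (\<beta> / 2) ^ (n - j) else 0)"
proof -
  have "mcoeff (p_beta n) m =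
      (\<Sum>k<n. if \<exists>i. m = single i (n - k) then of_nat (n choose k) * (\<beta> / 2) ^ k else 0)"
    unfolding p_beta_def mcoeff_sum mcoeff_mscale
    by (rule sum.cong) (auto simp: mcoeff_power_sum)
  also have "\<dots> = (\<Sum>j=1..n. if \<exists>i. m = single i j then of_nat (n choose j) * (\<beta> / 2) ^ (n - j) else 0)"
    by (rule sum.reindex_bij_witness[where i = "\<lambda>j. n - j" and j = "\<lambda>k. n - k"])
      (auto simp: binomial_symmetric[symmetric])
  finally show ?thesis .
qed

lemma mcoeff_p_beta_single:
  assumes "1 \<le> j" "j \<le> n"
  shows "mcoeff (p_beta n) (single i j) = of_nat (n choose j) * (\<beta> / 2) ^ (n - j)"
proof -
  have "mcoeff (p_beta n) (single i j) =
      (\<Sum>l=1..n. if l = j then of_nat (n choose j) * (\<beta> / 2) ^ (n - j) else 0)"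
    unfolding mcoeff_p_beta by (rule sum.cong) (use assms single_eq_single_iff[of j i] in auto)
  then show ?thesis using assms by simp
qed

lemma mcoeff_p_beta_nonzeroE:
  assumes "mcoeff (p_beta n) m \<noteq> 0"
  obtains i j where "1 \<le> j" "j \<le> n" "m = single i j"
  using assms unfolding mcoeff_p_beta by (elim sum.not_neutral_contains_not_neutral) (auto split: if_splits)

lemma prod_parts_empty [simp]: "prod_parts f {#} = 1"
  by (simp add: prod_parts_def)

lemma prod_parts_add_mset [simp]: "prod_parts f (add_mset k \<mu>) = f k * prod_parts f \<mu>"
  by (simp add: prod_parts_def)

lemma prod_parts_union: "prod_parts f (\<mu> + \<nu>) = prod_parts f \<mu> * prod_parts f \<nu>"
  by (simp add: prod_parts_def)

lemma add_mset_partitions: "add_mset k \<mu> \<in> partitions \<longleftrightarrow> k > 0 \<and> \<mu> \<in> partitions"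
  by (auto simp: partitions_def)

text \<open>Each factor contributes a power of one variable with exponent at most its index; the
  variables may coincide.\<close>

lemma prod_p_beta_support:
  assumes "mcoeff (prod_parts p_beta \<nu>) m \<noteq> 0"
  shows "card (keys m) \<le> size \<nu> \<and> total_degree m \<le> \<Sum>\<^sub># \<nu>"
  using assms
proof (induction \<nu> arbitrary: m)
  case empty
  then show ?case by (auto simp: mcoeff_1 total_degree_def split: if_splits)
next
  case (add k \<nu>)
  from add.prems obtain a b where ab: "a + b = m"
    "mcoeff (p_beta k) a \<noteq> 0" "mcoeff (prod_parts p_beta \<nu>) b \<noteq> 0"
    by (auto simp: mcoeff_mult splits_iff elim!: sum.not_neutral_contains_not_neutral)
  from ab(2) obtain i j where "1 \<le> j" "j \<le> k" "a = single i j"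
    by (rule mcoeff_p_beta_nonzeroE)
  then have "card (keys a) \<le> 1" "total_degree a \<le> k"
    by (auto simp: total_degree_single)
  with add.IH[OF ab(3)] card_keys_add_le[of a b] total_degree_add[of a b] ab(1)
  show ?case by auto
qed

text \<open>Equality in both bounds forces every factor to give its top power, with coefficient 1,
  in a variable of its own. The coefficient thus counts assignments of parts to variables; recording
  it as a natural number rules out cancellation between the terms.\<close>

lemma prod_p_beta_leading:
  assumes "\<nu> \<in> partitions" "card (keys m) = size \<nu>" "total_degree m = \<Sum>\<^sub># \<nu>"
  shows "\<exists>c. mcoeff (prod_parts p_beta \<nu>) m = of_nat c \<and> (c > 0 \<longleftrightarrow> shape m = \<nu>)"
  using assms
proof (induction \<nu> arbitrary: m)
  case empty
  then have "m = 0" by (simp add: total_degree_eq_0)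
  then show ?case by (intro exI[of _ 1]) (simp add: mcoeff_1 shape_def)
next
  case (add k \<nu>)
  have k: "k > 0" and \<nu>: "\<nu> \<in> partitions" using add.prems(1) by (auto simp: add_mset_partitions)
  \<comment> \<open>A single term of the product is already a count: a nonzero one must have
    \<open>j = k\<close> and disjoint supports. The last clause marks the terms that are certainly
    positive.\<close>
  have tm: "\<exists>c. mcoeff (p_beta k) a * mcoeff (prod_parts p_beta \<nu>) b = of_nat c \<and>
      (c > 0 \<longrightarrow> shape m = add_mset k \<nu>) \<and> (\<forall>i. a = single i k \<and> shape b = \<nu> \<longrightarrow> c > 0)"
    if ab: "a + b = m" for a b
  proof (cases "mcoeff (p_beta k) a = 0 \<or> mcoeff (prod_parts p_beta \<nu>) b = 0")
    case True
    have False if "a = single i k" "shape b = \<nu>" for i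
    proof -
      have "\<exists>c. mcoeff (prod_parts p_beta \<nu>) b = of_nat c \<and> (c > 0 \<longleftrightarrow> shape b = \<nu>)"
        by (rule add.IH[OF \<nu>]) (use that in \<open>auto simp: size_shape[symmetric] sum_mset_shape[symmetric]\<close>)
      moreover have "mcoeff (p_beta k) a = 1"
        using that k by (simp add: mcoeff_p_beta_single)
      ultimately show False using True that by auto
    qed
    then show ?thesis using True by (intro exI[of _ 0]) auto
  next
    case False
    then obtain i j where j: "1 \<le> j" "j \<le> k" "a = single i j"
      using mcoeff_p_beta_nonzeroE by metis
    have a: "card (keys a) = 1" "total_degree a = j"
      using j by (auto simp: total_degree_single)
    have b: "card (keys b) \<le> size \<nu>" "total_degree b \<le> \<Sum>\<^sub># \<nu>"
      using prod_p_beta_support[of \<nu> b] False by auto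
    have deg: "total_degree b = \<Sum>\<^sub># \<nu>" "j = k"
      using total_degree_add[of a b] add.prems(3) a b j ab by auto
    have card: "card (keys b) = size \<nu>"
      using card_keys_add_le[of a b] add.prems(2) a b ab by auto
    have "card (keys a) + card (keys b) = card (keys a \<union> keys b) + card (keys a \<inter> keys b)"
      by (rule card_Un_Int) auto
    then have "keys a \<inter> keys b = {}"
      using add.prems(2) card a ab by (auto simp: keys_add[symmetric])
    then have shape: "shape m = add_mset k (shape b)"
      using shape_add_disjoint[of a b] ab j(3) deg k by (simp add: shape_single)
    have "mcoeff (p_beta k) a = 1"
      using j deg k by (simp add: mcoeff_p_beta_single)
    then show ?thesis
      using add.IH[OF \<nu> card deg(1)] shape by auto
  qed
  define C where "C p = (SOME c. mcoeff (p_beta k) (fst p) * mcoeff (prod_parts p_beta \<nu>) (snd p) = of_nat c \<and>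
      (c > 0 \<longrightarrow> shape m = add_mset k \<nu>) \<and> (\<forall>i. fst p = single i k \<and> shape (snd p) = \<nu> \<longrightarrow> c > 0))" for p
  have C: "mcoeff (p_beta k) (fst p) * mcoeff (prod_parts p_beta \<nu>) (snd p) = of_nat (C p)"
    "C p > 0 \<longrightarrow> shape m = add_mset k \<nu>"
    "\<forall>i. fst p = single i k \<and> shape (snd p) = \<nu> \<longrightarrow> C p > 0" if "p \<in> splits m" for p
    using someI_ex[OF tm[of "fst p" "snd p"]] that unfolding C_def[symmetric]
    by (auto simp: splits_def)
  show ?case
  proof (intro exI[of _ "\<Sum>p\<in>splits m. C p"] conjI iffI)
    show "mcoeff (prod_parts p_beta (add_mset k \<nu>)) m = of_nat (\<Sum>p\<in>splits m. C p)"
      by (simp add: mcoeff_mult case_prod_unfold C(1))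
    assume "0 < (\<Sum>p\<in>splits m. C p)"
    then show "shape m = add_mset k \<nu>"
      using C(2) by (metis less_numeral_extra(3) not_gr_zero sum.neutral)
  next
    assume sh: "shape m = add_mset k \<nu>"
    then have "k \<in># shape m" by simp
    then obtain i where i: "i \<in> keys m" "lookup m i = k"
      by (auto simp: set_mset_shape)
    \<comment> \<open>Taking the part \<open>k\<close> off at position \<open>i\<close> gives one
      positive term, which suffices since no term is negative.\<close>
    let ?b = "m - single i k"
    have m: "single i k + ?b = m"
      by (rule poly_mapping_eqI) (use i in \<open>auto simp: lookup_add lookup_minus lookup_single when_def\<close>)
    have "shape m = shape (single i k) + shape ?b"
      by (subst (1) m[symmetric], rule shape_add_disjoint)
        (use i in \<open>auto simp: in_keys_iff lookup_minus lookup_single when_def split: if_splits\<close>)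
    then have "shape ?b = \<nu>" using sh k by (simp add: shape_single)
    then have "C (single i k, ?b) > 0"
      using C(3)[of "(single i k, ?b)"] m by (auto simp: splits_iff)
    moreover have "C (single i k, ?b) \<le> (\<Sum>p\<in>splits m. C p)"
      by (rule member_le_sum) (use m in \<open>auto simp: splits_iff finite_splits\<close>)
    ultimately show "0 < (\<Sum>p\<in>splits m. C p)" by simp
  qed
qed

lemma prod_p_beta_leading_nonzero:
  assumes "\<nu> \<in> partitions" "shape m = \<nu>"
  shows "mcoeff (prod_parts p_beta \<nu>) m \<noteq> 0"
  using prod_p_beta_leading[OF assms(1), of m] assms(2) sum_mset_shape[of m] size_shape[of m] by auto

text \<open>Triangularity: a monomial that is not below \<nu> in the order can occur only by
  attaining both bounds, and then it has shape \<nu>.\<close>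

lemma prod_p_beta_leading_other:
  assumes "\<nu> \<in> partitions" "size \<nu> \<le> card (keys m)" "size \<nu> = card (keys m) \<Longrightarrow> \<Sum>\<^sub># \<nu> \<le> total_degree m"
    "shape m \<noteq> \<nu>"
  shows "mcoeff (prod_parts p_beta \<nu>) m = 0"
proof (rule ccontr)
  assume *: "mcoeff (prod_parts p_beta \<nu>) m \<noteq> 0"
  with prod_p_beta_support[OF *] assms have "card (keys m) = size \<nu>" "total_degree m = \<Sum>\<^sub># \<nu>" by auto
  with prod_p_beta_leading[OF assms(1) this] * assms(4) show False by auto
qed

section \<open>The dual cancellation property\<close>

text \<open>The substitution sends a monomial \<open>m\<close> to \<open>dvar m\<close> times
  \<open>drop2 m\<close>. Both maps are multiplicative, which makes it a ring homomorphism.\<close>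

definition dvar :: "monom \<Rightarrow> qbeta poly" where
  "dvar m = [:0, 1:] ^ lookup m 0 * [:- \<beta>, - 1:] ^ lookup m 1"

definition drop2 :: "monom \<Rightarrow> monom" where
  "drop2 m = m - single 0 (lookup m 0) - single 1 (lookup m 1)"

text \<open>The cutoff \<open>d\<close> makes the fibre finite and independent of the series, so
  that sums over it are additive in the series.\<close>

definition dfiber :: "nat \<Rightarrow> monom \<Rightarrow> monom set" where
  "dfiber d m = {n. drop2 n = m \<and> total_degree n \<le> d}"

lemma lookup_drop2: "lookup (drop2 m) i = (if i = 0 \<or> i = 1 then 0 else lookup m i)"
  by (auto simp: drop2_def lookup_minus lookup_single when_def)

lemma drop2_add: "drop2 (a + b) = drop2 a + drop2 b"
  by (rule poly_mapping_eqI) (simp add: lookup_drop2 lookup_add)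

lemma dvar_add: "dvar (a + b) = dvar a * dvar b"
  by (simp add: dvar_def lookup_add power_add mult_ac)

lemma drop2_decomp: "single 0 (lookup n 0) + single 1 (lookup n 1) + drop2 n = n"
  by (rule poly_mapping_eqI) (auto simp: lookup_add lookup_drop2 lookup_single when_def)

lemma drop2_eqD:
  assumes "drop2 n = m"
  shows "n = single 0 (lookup n 0) + single 1 (lookup n 1) + m"
  using drop2_decomp[of n] assms by simp

lemma lookup_le_total_degree: "lookup m i \<le> total_degree m"
proof (cases "i \<in> keys m")
  case True
  then show ?thesis unfolding total_degree_def by (intro member_le_sum) auto
qed (simp add: in_keys_iff)

lemma finite_dfiber: "finite (dfiber d m)"
proof (rule finite_subset)
  show "dfiber d m \<subseteq> (\<lambda>(i, j). single 0 i + single 1 j + m) ` ({..d} \<times> {..d})"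
  proof
    fix n assume "n \<in> dfiber d m"
    then have "n = single 0 (lookup n 0) + single 1 (lookup n 1) + m" "total_degree n \<le> d"
      using drop2_eqD by (auto simp: dfiber_def)
    then show "n \<in> (\<lambda>(i, j). single 0 i + single 1 j + m) ` ({..d} \<times> {..d})"
      using le_trans[OF lookup_le_total_degree]
      by (intro image_eqI[of _ _ "(lookup n 0, lookup n 1)"]) auto
  qed
qed auto

section \<open>Degree bounds, linearity and multiplicativity of the substitution\<close>

definition deg_le :: "nat \<Rightarrow> 'a::zero mfps \<Rightarrow> bool" where
  "deg_le d f \<longleftrightarrow> (\<forall>m. mcoeff f m \<noteq> 0 \<longrightarrow> total_degree m \<le> d)"

lemma bounded_degree_iff: "bounded_degree f \<longleftrightarrow> (\<exists>d. deg_le d f)"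
  by (simp add: bounded_degree_def deg_le_def)

lemma deg_le_mono: "deg_le d f \<Longrightarrow> d \<le> e \<Longrightarrow> deg_le e f"
  by (meson deg_le_def le_trans)

lemma deg_le_mult:
  assumes "deg_le d f" "deg_le e g"
  shows "deg_le (d + e) (f * g)"
  unfolding deg_le_def
proof (intro allI impI)
  fix m assume "mcoeff (f * g) m \<noteq> 0"
  then obtain a b where "a + b = m" "mcoeff f a * mcoeff g b \<noteq> 0"
    by (auto simp: mcoeff_mult splits_iff elim!: sum.not_neutral_contains_not_neutral)
  moreover from this have "mcoeff f a \<noteq> 0" "mcoeff g b \<noteq> 0" by auto
  ultimately show "total_degree m \<le> d + e"
    using assms by (auto simp: deg_le_def total_degree_add intro!: add_mono)
qed

text \<open>Exponent pairs for the first two variables correspond to the monomials of a fibre. If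
  \<open>m\<close> involves one of these variables the fibre is empty, in agreement with the default
  0 in \<open>dual_subst\<close>.\<close>

lemma mcoeff_dual_subst:
  assumes "deg_le d f"
  shows "mcoeff (dual_subst f) m = (\<Sum>n\<in>dfiber d m. smult (mcoeff f n) (dvar n))"
proof (cases "lookup m 0 = 0 \<and> lookup m 1 = 0")
  case True
  let ?emb = "\<lambda>(i, j). single 0 i + single 1 j + m"
  let ?g = "\<lambda>(i, j). smult (mcoeff f (single 0 i + single 1 j + m)) ([:0, 1:] ^ i * [:- \<beta>, - 1:] ^ j)"
  have drop: "drop2 (single 0 i + single 1 j + m) = m" for i j
    by (rule poly_mapping_eqI) (use True in \<open>auto simp: lookup_drop2 lookup_add lookup_single\<close>)
  have lookups: "lookup (single 0 i + single 1 j + m) 0 = i"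
      "lookup (single 0 i + single 1 j + m) 1 = j" for i j
    using True by (auto simp: lookup_add lookup_single)
  let ?A = "{p. total_degree (?emb p) \<le> d}"
  have "?A \<subseteq> {..d} \<times> {..d}"
  proof (rule subrelI)
    fix i j assume "(i, j) \<in> ?A"
    then have "total_degree (single 0 i + single 1 j + m) \<le> d" by simp
    then show "(i, j) \<in> {..d} \<times> {..d}"
      using lookup_le_total_degree[of "single 0 i + single 1 j + m" 0]
        lookup_le_total_degree[of "single 0 i + single 1 j + m" 1] by (simp only: lookups) simp
  qed
  then have fin: "finite ?A" by (rule finite_subset) auto
  have "Sum_any ?g = sum ?g ?A"
    by (rule Sum_any.expand_superset[OF fin]) (use assms in \<open>auto simp: deg_le_def\<close>)
  also have "\<dots> = (\<Sum>n\<in>dfiber d m. smult (mcoeff f n) (dvar n))"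
  proof (rule sum.reindex_bij_witness[where i = "\<lambda>n. (lookup n 0, lookup n 1)" and j = ?emb], goal_cases)
    case (1 p)
    then show ?case by (cases p) (simp only: split lookups)
  next
    case (2 p)
    then show ?case by (cases p) (auto simp: dfiber_def drop[unfolded One_nat_def])
  next
    case (3 n)
    then show ?case using drop2_eqD[of n m] by (simp add: dfiber_def)
  next
    case (4 n)
    then show ?case using drop2_eqD[of n m] by (simp add: dfiber_def)
  next
    case (5 p)
    then show ?case by (cases p) (simp only: split lookups dvar_def)
  qed
  finally show ?thesis
    using True by (simp add: dual_subst_def)
next
  case False
  then have "dfiber d m = {}"
    by (auto simp: dfiber_def lookup_drop2)
  with False show ?thesis by (auto simp: dual_subst_def)
qed

lemma dual_subst_add:
  assumes "deg_le d f" "deg_le d g"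
  shows "dual_subst (f + g) = dual_subst f + dual_subst g"
proof -
  have "deg_le d (f + g)"
    unfolding deg_le_def
  proof (intro allI impI)
    fix m assume "mcoeff (f + g) m \<noteq> 0"
    then have "mcoeff f m \<noteq> 0 \<or> mcoeff g m \<noteq> 0" by (auto simp: mcoeff_add)
    with assms show "total_degree m \<le> d" by (auto simp: deg_le_def)
  qed
  then show ?thesis
    using assms by (intro mfps_eqI) (simp add: mcoeff_dual_subst mcoeff_add smult_add_left sum.distrib)
qed

lemma deg_le_mscale: "deg_le d f \<Longrightarrow> deg_le d (mscale c f)"
  unfolding deg_le_def mcoeff_mscale by (metis mult_zero_right)

lemma mcoeff_dual_subst_mscale:
  assumes "deg_le d f"
  shows "mcoeff (dual_subst (mscale c f)) m = smult c (mcoeff (dual_subst f) m)"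
proof -
  have "mcoeff (dual_subst (mscale c f)) m = (\<Sum>n\<in>dfiber d m. smult c (smult (mcoeff f n) (dvar n)))"
    by (simp add: mcoeff_dual_subst[OF deg_le_mscale[OF assms]] mcoeff_mscale)
  also have "\<dots> = smult c (\<Sum>n\<in>dfiber d m. smult (mcoeff f n) (dvar n))"
    by (induction rule: finite_induct[OF finite_dfiber]) (auto simp: smult_add_right)
  finally show ?thesis using assms by (simp add: mcoeff_dual_subst)
qed

text \<open>Both sides sum over pairs \<open>(a, b)\<close> with \<open>drop2 (a + b) = m\<close>,
  grouped once by \<open>a + b\<close> and once by \<open>(drop2 a, drop2 b)\<close>.\<close>

lemma dual_subst_mult:
  assumes f: "deg_le d f" and g: "deg_le e g"
  shows "dual_subst (f * g) = dual_subst f * dual_subst g"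
proof (rule mfps_eqI)
  fix m
  let ?F = "\<lambda>a. smult (mcoeff f a) (dvar a)" and ?G = "\<lambda>b. smult (mcoeff g b) (dvar b)"
  have "mcoeff (dual_subst (f * g)) m =
      (\<Sum>n\<in>dfiber (d + e) m. \<Sum>p\<in>splits n. ?F (fst p) * ?G (snd p))"
    unfolding mcoeff_dual_subst[OF deg_le_mult[OF f g]]
  proof (rule sum.cong[OF refl])
    fix n
    have "smult (mcoeff (f * g) n) (dvar n)
        = (\<Sum>p\<in>splits n. smult (mcoeff f (fst p) * mcoeff g (snd p)) (dvar n))"
      by (simp add: mcoeff_mult case_prod_unfold smult_sum)
    also have "\<dots> = (\<Sum>p\<in>splits n. ?F (fst p) * ?G (snd p))"
      by (rule sum.cong) (auto simp: splits_def dvar_add mult_ac)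
    finally show "smult (mcoeff (f * g) n) (dvar n) = (\<Sum>p\<in>splits n. ?F (fst p) * ?G (snd p))" .
  qed
  also have "\<dots> = (\<Sum>q\<in>(SIGMA n:dfiber (d + e) m. splits n). ?F (fst (snd q)) * ?G (snd (snd q)))"
    by (simp add: sum.Sigma finite_dfiber finite_splits case_prod_unfold)
  also have "\<dots> = (\<Sum>q\<in>(SIGMA r:splits m. dfiber d (fst r) \<times> dfiber e (snd r)).
      ?F (fst (snd q)) * ?G (snd (snd q)))"
  \<comment> \<open>The cutoffs do not match: \<open>a + b\<close> may have degree at most
    \<open>d + e\<close> although \<open>a\<close> exceeds \<open>d\<close> or \<open>b\<close>
    exceeds \<open>e\<close>. Such pairs have a zero factor and are set aside as neutral.\<close>
  proof (rule sum.reindex_bij_witness_not_neutral[where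
        S' = "{q \<in> (SIGMA n:dfiber (d + e) m. splits n). ?F (fst (snd q)) * ?G (snd (snd q)) = 0}" and
        T' = "{q \<in> (SIGMA r:splits m. dfiber d (fst r) \<times> dfiber e (snd r)). ?F (fst (snd q)) * ?G (snd (snd q)) = 0}" and
        i = "\<lambda>(_, (a, b)). (a + b, (a, b))" and j = "\<lambda>(_, (a, b)). ((drop2 a, drop2 b), (a, b))"], goal_cases)
    case 1
    have "finite (SIGMA n:dfiber (d + e) m. splits n)"
      by (intro finite_SigmaI finite_dfiber finite_splits)
    then show ?case by (rule rev_finite_subset) (rule Collect_restrict)
  next
    case 2
    have "finite (SIGMA r:splits m. dfiber d (fst r) \<times> dfiber e (snd r))"
      by (intro finite_SigmaI finite_dfiber finite_splits)
    then show ?case by (rule rev_finite_subset) (rule Collect_restrict)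
  next
    case (3 q)
    then show ?case by (cases q) (auto simp: splits_def)
  next
    case (5 q)
    then show ?case by (cases q) (auto simp: dfiber_def)
  next
    case (9 q)
    then show ?case by (simp add: case_prod_unfold)
  next
    case (4 q)
    obtain n a b where q: "q = (n, a, b)" by (rule prod_cases3)
    from 4 have n: "drop2 n = m" "a + b = n" and nz: "?F a * ?G b \<noteq> 0"
      by (simp_all add: q dfiber_def splits_iff)
    from nz have "mcoeff f a \<noteq> 0" "mcoeff g b \<noteq> 0" by auto
    then have "total_degree a \<le> d" "total_degree b \<le> e"
      using f g by (simp_all add: deg_le_def)
    moreover have "drop2 a + drop2 b = m"
      using n by (simp add: drop2_add[symmetric])
    ultimately show ?case
      using nz by (simp add: q dfiber_def splits_iff)
  next
    case (6 q)
    obtain r a b where q: "q = (r, a, b)" by (rule prod_cases3)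
    from 6 have r: "fst r + snd r = m" and a: "drop2 a = fst r" "total_degree a \<le> d"
      and b: "drop2 b = snd r" "total_degree b \<le> e" and nz: "?F a * ?G b \<noteq> 0"
      by (simp_all add: q dfiber_def splits_def case_prod_unfold)
    show ?case
      using nz r a b by (simp add: q dfiber_def splits_iff drop2_add total_degree_add add_mono)
  qed simp_all
  also have "\<dots> = (\<Sum>r\<in>splits m. \<Sum>p\<in>dfiber d (fst r) \<times> dfiber e (snd r). ?F (fst p) * ?G (snd p))"
    by (simp add: sum.Sigma finite_dfiber finite_splits case_prod_unfold)
  also have "\<dots> = (\<Sum>r\<in>splits m. (\<Sum>a\<in>dfiber d (fst r). ?F a) * (\<Sum>b\<in>dfiber e (snd r). ?G b))"
    by (simp only: sum_product sum.cartesian_product case_prod_unfold)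
  also have "\<dots> = mcoeff (dual_subst f * dual_subst g) m"
    by (simp add: mcoeff_mult mcoeff_dual_subst[OF f] mcoeff_dual_subst[OF g] case_prod_unfold)
  finally show "mcoeff (dual_subst (f * g)) m = mcoeff (dual_subst f * dual_subst g) m" .
qed

section \<open>Series with the cancellation property form a subalgebra\<close>

lemma symmetric_mult:
  assumes "symmetric f" "symmetric g"
  shows "symmetric (f * g)"
  unfolding symmetric_def
proof (intro allI impI)
  fix \<pi> :: "nat \<Rightarrow> nat" and m assume \<pi>: "bij \<pi>"
  let ?k = "Poly_Mapping.map_key \<pi>" and ?k' = "Poly_Mapping.map_key (inv \<pi>)"
  have \<pi>': "bij (inv \<pi>)" using \<pi> by (rule bij_imp_bij_inv)
  have inv: "?k' (?k n) = n" "?k (?k' n) = n" for n :: monom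
    by (auto intro!: poly_mapping_eqI simp: lookup_map_key[OF \<pi>] lookup_map_key[OF \<pi>']
        surj_f_inv_f[OF bij_is_surj[OF \<pi>]] inv_f_f[OF bij_is_inj[OF \<pi>]])
  have add: "?k (a + b) = ?k a + ?k b" "?k' (a + b) = ?k' a + ?k' b" for a b :: monom
    by (auto intro!: poly_mapping_eqI simp: lookup_map_key[OF \<pi>] lookup_map_key[OF \<pi>'] lookup_add)
  have sym: "mcoeff f (?k' a) = mcoeff f a" "mcoeff g (?k' a) = mcoeff g a" for a
    using assms \<pi>' by (auto simp: symmetric_def)
  show "mcoeff (f * g) (?k m) = mcoeff (f * g) m"
    unfolding mcoeff_mult
  proof (rule sum.reindex_bij_witness[where i = "\<lambda>(a, b). (?k a, ?k b)" and j = "\<lambda>(a, b). (?k' a, ?k' b)"],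
      goal_cases)
    case (2 p)
    then have "?k' (fst p + snd p) = m" by (auto simp: splits_def inv)
    then show ?case by (simp add: splits_def add case_prod_unfold)
  next
    case (4 p)
    then have "?k (fst p + snd p) = ?k m" by (auto simp: splits_def)
    then show ?case by (simp add: splits_def add case_prod_unfold)
  qed (simp_all add: case_prod_unfold inv sym)
qed

lemma gGammaI:
  assumes "symmetric f" "deg_le d f" "\<And>m. degree (mcoeff (dual_subst f) m) = 0"
  shows "f \<in> g\<Gamma>"
  using assms by (auto simp: gGamma_def Lambda_def bounded_degree_iff dual_KQ_cancellation_def)

lemma gGammaE:
  assumes "f \<in> g\<Gamma>"
  obtains d where "symmetric f" "deg_le d f" "\<And>m. degree (mcoeff (dual_subst f) m) = 0"
  using assms by (auto simp: gGamma_def Lambda_def bounded_degree_iff dual_KQ_cancellation_def)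

lemma gGamma_one: "1 \<in> g\<Gamma>"
proof (rule gGammaI[where d = 0])
  show "symmetric (1 :: qbeta mfps)"
  proof (rule symmetricI)
    fix a b assume "shape a = shape b"
    then have "a = 0 \<longleftrightarrow> b = 0" by (metis sum_mset_shape total_degree_eq_0)
    then show "mcoeff 1 a = (mcoeff 1 b :: qbeta)" by (simp add: mcoeff_1)
  qed
  show d: "deg_le 0 (1 :: qbeta mfps)"
    by (auto simp: deg_le_def mcoeff_1 total_degree_def split: if_splits)
  fix m
  have "degree (smult (mcoeff 1 n) (dvar n)) \<le> 0" for n
    by (simp add: mcoeff_1 dvar_def)
  then have "degree (mcoeff (dual_subst 1) m) \<le> 0"
    unfolding mcoeff_dual_subst[OF d] by (intro degree_sum_le finite_dfiber) 
  then show "degree (mcoeff (dual_subst 1) m) = 0" by simp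
qed

lemma gGamma_mult:
  assumes "f \<in> g\<Gamma>" "g \<in> g\<Gamma>"
  shows "f * g \<in> g\<Gamma>"
proof -
  obtain d where f: "symmetric f" "deg_le d f" "\<And>m. degree (mcoeff (dual_subst f) m) = 0"
    using gGammaE[OF assms(1)] by blast
  obtain e where g: "symmetric g" "deg_le e g" "\<And>m. degree (mcoeff (dual_subst g) m) = 0"
    using gGammaE[OF assms(2)] by blast
  have "degree (mcoeff (dual_subst f) a * mcoeff (dual_subst g) b) \<le> 0" for a b
    using degree_mult_le[of "mcoeff (dual_subst f) a" "mcoeff (dual_subst g) b"] f(3) g(3) by simp
  then have "degree (mcoeff (dual_subst f * dual_subst g) m) \<le> 0" for m
    unfolding mcoeff_mult by (intro degree_sum_le finite_splits) (auto simp: case_prod_unfold)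
  then show ?thesis
    by (intro gGammaI[OF symmetric_mult[OF f(1) g(1)] deg_le_mult[OF f(2) g(2)]])
      (simp add: dual_subst_mult[OF f(2) g(2)])
qed

lemma gGamma_subspace: "mfps.subspace g\<Gamma>"
proof (rule mfps.subspaceI)
  show scale: "mscale c f \<in> g\<Gamma>" if f: "f \<in> g\<Gamma>" for c f
  proof -
    obtain d where f: "symmetric f" "deg_le d f" "\<And>m. degree (mcoeff (dual_subst f) m) = 0"
      using gGammaE[OF f] by blast
    show ?thesis
      by (rule gGammaI[OF _ deg_le_mscale[OF f(2)]])
        (use f in \<open>auto simp: symmetric_def mcoeff_mscale mcoeff_dual_subst_mscale\<close>)
  qed
  show "0 \<in> g\<Gamma>"
    using scale[OF gGamma_one, of 0] by simp
  show "f + g \<in> g\<Gamma>" if f: "f \<in> g\<Gamma>" and g: "g \<in> g\<Gamma>" for f g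
  proof -
    obtain d where f: "symmetric f" "deg_le d f" "\<And>m. degree (mcoeff (dual_subst f) m) = 0"
      using gGammaE[OF f] by blast
    obtain e where g: "symmetric g" "deg_le e g" "\<And>m. degree (mcoeff (dual_subst g) m) = 0"
      using gGammaE[OF g] by blast
    have d: "deg_le (max d e) f" "deg_le (max d e) g"
      by (rule deg_le_mono[OF f(2)], simp, rule deg_le_mono[OF g(2)], simp)
    have "degree (mcoeff (dual_subst (f + g)) m) \<le> 0" for m
      unfolding dual_subst_add[OF d] mcoeff_add by (rule degree_add_le) (simp_all add: f g)
    moreover have "symmetric (f + g)"
      using f g by (simp add: symmetric_def mcoeff_add)
    moreover have "deg_le (max d e) (f + g)"
      unfolding deg_le_def
    proof (intro allI impI)
      fix m assume "mcoeff (f + g) m \<noteq> 0"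
      then have "mcoeff f m \<noteq> 0 \<or> mcoeff g m \<noteq> 0" by (auto simp: mcoeff_add)
      with d show "total_degree m \<le> max d e" by (auto simp: deg_le_def)
    qed
    ultimately show ?thesis by (intro gGammaI) auto
  qed
qed

section \<open>Cancellation for the deformed power sums of odd index\<close>

lemma symmetric_p_beta: "symmetric (p_beta n)"
proof (rule symmetricI)
  fix a b assume ab: "shape a = shape b"
  have single_iff: "(\<exists>i. m = single i j) \<longleftrightarrow> shape m = {#j#}" if "j \<ge> 1" for m j
  proof
    assume sh: "shape m = {#j#}"
    then have "card (keys m) = 1" by (metis size_shape size_single)
    then obtain i where i: "keys m = {i}" by (auto simp: card_1_singleton_iff)
    then have "lookup m i = j" using sh by (simp add: shape_def)
    then have "m = single i j"
      by (intro poly_mapping_eqI) (use i in \<open>auto simp: lookup_single when_def in_keys_iff\<close>)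
    then show "\<exists>i. m = single i j" by blast
  qed (use that in \<open>auto simp: shape_single\<close>)
  show "mcoeff (p_beta n) a = mcoeff (p_beta n) b"
    unfolding mcoeff_p_beta by (rule sum.cong) (auto simp: single_iff ab)
qed

lemma deg_le_p_beta: "deg_le n (p_beta n)"
  unfolding deg_le_def by (metis mcoeff_p_beta_nonzeroE total_degree_single)

text \<open>
  With \<open>u = t + \<beta>/2\<close> the substituted pair is \<open>u - \<beta>/2, -u - \<beta>/2\<close>, and the summand
  \<open>(x + \<beta>/2)\<^sup>n - (\<beta>/2)\<^sup>n\<close> of \<open>p_beta n\<close> takes opposite values on it up to a constant when \<open>n\<close> is odd.
\<close>

lemma p_beta_in_gGamma:
  assumes "odd n"
  shows "p_beta n \<in> g\<Gamma>"
proof (rule gGammaI[OF symmetric_p_beta deg_le_p_beta])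
  fix m
  show "degree (mcoeff (dual_subst (p_beta n)) m) = 0"
  proof (cases "m = 0")
    case False
    \<comment> \<open>A monomial of \<open>p_beta n\<close> has only one variable; over
      \<open>m \<noteq> 0\<close> this variable survives the substitution, so \<open>dvar l\<close>
      is 1.\<close>
    have "degree (smult (mcoeff (p_beta n) l) (dvar l)) \<le> 0" if "l \<in> dfiber n m" for l
    proof (cases "mcoeff (p_beta n) l = 0")
      case nz: False
      then obtain i j where l: "1 \<le> j" "j \<le> n" "l = single i j"
        by (rule mcoeff_p_beta_nonzeroE)
      have "i \<noteq> 0 \<and> i \<noteq> 1"
      proof (rule ccontr)
        assume "\<not> (i \<noteq> 0 \<and> i \<noteq> 1)"
        then have "drop2 l = 0"
          by (intro poly_mapping_eqI) (auto simp: l lookup_drop2 lookup_single when_def)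
        then show False using that False by (simp add: dfiber_def)
      qed
      then show ?thesis by (simp add: l dvar_def lookup_single)
    qed simp
    then have "degree (mcoeff (dual_subst (p_beta n)) m) \<le> 0"
      unfolding mcoeff_dual_subst[OF deg_le_p_beta] by (intro degree_sum_le finite_dfiber)
    then show ?thesis by simp
  next
    case True
    define c where "c j = of_nat (n choose j) * (\<beta> / 2) ^ (n - j)" for j
    let ?s = "[:- \<beta>, - 1:] :: qbeta poly" and ?t = "[:0, 1:] :: qbeta poly"
    let ?A = "single 0 ` {1..n}" and ?B = "single 1 ` {1..n}"
    let ?h = "\<lambda>l. smult (mcoeff (p_beta n) l) (dvar l)"
    have "mcoeff (dual_subst (p_beta n)) m = (\<Sum>l\<in>dfiber n 0. ?h l)"
      using True by (simp add: mcoeff_dual_subst[OF deg_le_p_beta])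
    also have "\<dots> = (\<Sum>l\<in>?A \<union> ?B. ?h l)"
    proof (rule sum.mono_neutral_right[OF finite_dfiber])
      have "drop2 (single 0 j) = 0" "drop2 (single 1 j) = 0" for j
        by (rule poly_mapping_eqI; auto simp: lookup_drop2 lookup_single when_def)+
      then show "?A \<union> ?B \<subseteq> dfiber n 0"
        by (auto simp: dfiber_def total_degree_single)
      show "\<forall>l\<in>dfiber n 0 - (?A \<union> ?B). ?h l = 0"
      proof
        fix l assume l: "l \<in> dfiber n 0 - (?A \<union> ?B)"
        have "mcoeff (p_beta n) l = 0"
        proof (rule ccontr)
          assume "mcoeff (p_beta n) l \<noteq> 0"
          then obtain i j where ij: "1 \<le> j" "j \<le> n" "l = single i j"
            by (rule mcoeff_p_beta_nonzeroE)
          with l have "i \<noteq> 0" "i \<noteq> 1" by auto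
          then have "lookup (drop2 l) i = j" by (simp add: lookup_drop2 ij)
          with l ij show False by (auto simp: dfiber_def)
        qed
        then show "?h l = 0" by simp
      qed
    qed
    also have "\<dots> = (\<Sum>l\<in>?A. ?h l) + (\<Sum>l\<in>?B. ?h l)"
      by (rule sum.union_disjoint) (auto simp: single_eq_single_iff)
    also have "(\<Sum>l\<in>?A. ?h l) = (\<Sum>j=1..n. smult (c j) (?t ^ j))"
      by (subst sum.reindex)
        (auto simp: inj_on_def single_eq_single_iff mcoeff_p_beta_single c_def dvar_def lookup_single intro!: sum.cong)
    also have "(\<Sum>l\<in>?B. ?h l) = (\<Sum>j=1..n. smult (c j) (?s ^ j))"
      by (subst sum.reindex)
        (auto simp: inj_on_def single_eq_single_iff mcoeff_p_beta_single c_def dvar_def lookup_single intro!: sum.cong)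
    finally have eq: "mcoeff (dual_subst (p_beta n)) m =
      (\<Sum>j=1..n. smult (c j) (?t ^ j)) + (\<Sum>j=1..n. smult (c j) (?s ^ j))" .
    \<comment> \<open>The \<open>c j\<close> are the coefficients of the binomial expansion around
      \<beta>/2, whose term \<open>j = 0\<close> is missing from \<open>p_beta n\<close>.\<close>
    have binom: "(\<Sum>j=1..n. smult (c j) (x ^ j)) = (x + [:\<beta> / 2:]) ^ n - [:((\<beta> / 2) ^ n):]" for x :: "qbeta poly"
    proof -
      have "(x + [:\<beta> / 2:]) ^ n = (\<Sum>j\<le>n. smult (c j) (x ^ j))"
        unfolding binomial_ring
        by (rule sum.cong) (auto simp: c_def poly_const_pow of_nat_poly mult_ac)
      also have "\<dots> = smult (c 0) 1 + (\<Sum>j=1..n. smult (c j) (x ^ j))"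
        by (simp add: atMost_atLeast0 sum.atLeast_Suc_atMost)
      finally show ?thesis by (simp add: c_def)
    qed
    \<comment> \<open>For odd \<open>n\<close> the two powers now cancel and leave a
      constant.\<close>
    have "?s + [:\<beta> / 2:] = - (?t + [:\<beta> / 2:])"
      by simp
    then have "(?s + [:\<beta> / 2:]) ^ n = - ((?t + [:\<beta> / 2:]) ^ n)"
      using assms by (metis power_minus_odd)
    then show ?thesis
      unfolding eq binom by (simp del: add_pCons)
  qed
qed

lemma prod_p_beta_in_gGamma:
  assumes "\<mu> \<in> \<O>\<P>"
  shows "prod_parts p_beta \<mu> \<in> g\<Gamma>"
  using assms
proof (induction \<mu>)
  case (add k \<mu>)
  then show ?case
    by (auto simp: odd_partitions_def add_mset_partitions intro!: gGamma_mult p_beta_in_gGamma)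
qed (simp add: gGamma_one)

section \<open>Odd power sums form a basis\<close>

lemma gGamma_leading_odd:
  assumes f: "f \<in> g\<Gamma>" and m: "mcoeff f m \<noteq> 0"
    and len: "\<And>m'. mcoeff f m' \<noteq> 0 \<Longrightarrow> card (keys m') \<le> card (keys m)"
    and deg: "\<And>m'. mcoeff f m' \<noteq> 0 \<Longrightarrow> card (keys m') = card (keys m) \<Longrightarrow>
      total_degree m' \<le> total_degree m"
  shows "shape m \<in> \<O>\<P>"
proof -
  obtain d where f: "symmetric f" "deg_le d f" "\<And>m. degree (mcoeff (dual_subst f) m) = 0"
    using gGammaE[OF f] by blast
  have "odd k" if k: "k \<in># shape m" for k
  proof (rule ccontr)
    assume even: "\<not> odd k"
    have k0: "k > 0"
      using k shape_in_partitions[of m] by (auto simp: partitions_def intro: gr0I)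
    define \<rho> where "\<rho> = shape m - {#k#}"
    have \<rho>: "shape m = add_mset k \<rho>" using k by (simp add: \<rho>_def)
    have "\<rho> \<in> partitions"
      using shape_in_partitions[of m] by (auto simp: partitions_def \<rho>)
    \<comment> \<open>With the other parts moved off the first two variables, \<open>k\<close> can
      sit on either of these two; by symmetry both monomials have the coefficient of
      \<open>m\<close>.\<close>
    then obtain a where a: "shape a = \<rho>" "keys a \<inter> {0, 1} = {}"
      using ex_shape_avoiding[of \<rho> "{0, 1}"] by auto
    have a01: "lookup a 0 = 0" "lookup a 1 = 0" using a(2) by (auto simp: in_keys_iff)
    have shape_i: "shape (single i k + a) = shape m" if "i = 0 \<or> i = 1" for i
      by (subst shape_add_disjoint) (use a that k0 in \<open>auto simp: shape_single \<rho>\<close>)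
    have card_a: "Suc (card (keys a)) = card (keys m)"
      by (metis a(1) \<rho> size_add_mset size_shape)
    have deg_a: "k + total_degree a = total_degree m"
      by (metis a(1) \<rho> sum_mset.add_mset sum_mset_shape)
    have drop: "drop2 (single i k + a) = a" if "i = 0 \<or> i = 1" for i
      by (rule poly_mapping_eqI) (use that a01 in \<open>auto simp: lookup_drop2 lookup_add lookup_single when_def\<close>)
    let ?h = "\<lambda>n. coeff (smult (mcoeff f n) (dvar n)) k"
    let ?A = "{single 0 k + a, single 1 k + a}"
    have neq: "single 0 k + a \<noteq> single 1 k + a"
      using k0 by (simp add: single_eq_single_iff)
    have f_i: "mcoeff f (single i k + a) = mcoeff f m" if "i = 0 \<or> i = 1" for i
      by (rule symmetric_mcoeff_eq[OF f(1) shape_i[OF that]])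
    have "?A \<subseteq> dfiber d a"
    proof -
      have "total_degree (single i k + a) \<le> d" if "i = 0 \<or> i = 1" for i
        using f(2) m f_i[OF that] by (simp add: deg_le_def)
      then show ?thesis using drop by (auto simp: dfiber_def)
    qed
    \<comment> \<open>Reaching \<open>t^k\<close> needs \<open>i + j \<ge> k\<close>. Both variables
      together would exceed the maximal number of variables, and with only one of them the degree
      bound forces exponent \<open>k\<close>.\<close>
    moreover have "?h n = 0" if n: "n \<in> dfiber d a - ?A" for n
    proof (rule ccontr)
      assume nz: "?h n \<noteq> 0"
      then have fn: "mcoeff f n \<noteq> 0" and cn: "coeff (dvar n) k \<noteq> 0" by auto
      define i j where "i = lookup n 0" and "j = lookup n 1"
      have n_eq: "n = single 0 i + single 1 j + a"
        using n drop2_eqD[of n a] by (auto simp: dfiber_def i_def j_def)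
      have "degree (dvar n) \<le> i + j"
        unfolding dvar_def i_def[symmetric] j_def[symmetric]
        by (rule order_trans[OF degree_mult_le]) (auto simp: degree_power_eq intro!: add_mono)
      then have k_le: "k \<le> i + j"
        using cn le_degree le_trans by blast
      have keys_n: "keys n = keys (single 0 i) \<union> keys (single 1 j) \<union> keys a"
        by (simp add: n_eq keys_add)
      have notboth: "i = 0 \<or> j = 0"
      proof (rule ccontr)
        assume "\<not> (i = 0 \<or> j = 0)"
        then have "keys n = {0, 1} \<union> keys a" using keys_n by auto
        then have "card (keys n) = 2 + card (keys a)"
          using a(2) card_Un_disjoint[of "{0, 1}" "keys a"] by (simp add: Int_commute)
        with len[OF fn] card_a show False by simp
      qed
      have "keys n = insert (if j = 0 then 0 else 1) (keys a)"
        using keys_n notboth k_le k0 by auto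
      then have "card (keys n) = card (keys m)"
        using a(2) card_a by (auto simp: card_insert_if split: if_splits)
      then have "total_degree n \<le> k + total_degree a"
        using deg[OF fn] deg_a by simp
      then have "i + j = k"
        using k_le by (simp add: n_eq total_degree_add total_degree_single)
      then have "n \<in> ?A"
        using notboth by (auto simp: n_eq)
      with n show False by simp
    qed
    ultimately have "(\<Sum>n\<in>dfiber d a. ?h n) = (\<Sum>n\<in>?A. ?h n)"
      by (intro sum.mono_neutral_right finite_dfiber) auto
    also have "\<dots> = mcoeff f m * (coeff (dvar (single 0 k + a)) k + coeff (dvar (single 1 k + a)) k)"
      using neq f_i[of 0] f_i[of 1] by (simp add: distrib_left)
    also have "dvar (single 0 k + a) = [:0, 1:] ^ k"
      using a01 by (simp add: dvar_def lookup_add lookup_single)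
    also have "dvar (single 1 k + a) = [:- \<beta>, - 1:] ^ k"
      using a01 by (simp add: dvar_def lookup_add lookup_single)
    also have "coeff ([:0, 1:] ^ k) k = (1 :: qbeta)"
      using lead_coeff_power[of "[:0, 1 :: qbeta:]" k] by (simp add: degree_power_eq)
    also have "coeff ([:- \<beta>, - 1:] ^ k) k = (1 :: qbeta)"
      using lead_coeff_power[of "[:- \<beta>, - 1:]" k] even by (simp add: degree_power_eq)
    also have "(\<Sum>n\<in>dfiber d a. ?h n) = coeff (mcoeff (dual_subst f) a) k"
      by (simp add: mcoeff_dual_subst[OF f(2)] coeff_sum)
    also have "\<dots> = 0"
      using f(3)[of a] k0 by (simp add: coeff_eq_0)
    finally show False using m by simp
  qed
  then show ?thesis
    using shape_in_partitions by (simp add: odd_partitions_def)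
qed

text \<open>Infinitely many monomials may occur, but the degree bounds both the parts and their
  number; hence one finite combination can remove all leading monomials of a symmetric
  series.\<close>

lemma finite_shapes_of_deg_le:
  assumes "deg_le d f"
  shows "finite (shape ` {m. mcoeff f m \<noteq> 0})"
proof (rule finite_subset)
  show "shape ` {m. mcoeff f m \<noteq> 0} \<subseteq> {\<mu>. set_mset \<mu> \<subseteq> {..d} \<and> size \<mu> \<le> d}"
  proof (intro image_subsetI CollectI conjI)
    fix m assume "m \<in> {m. mcoeff f m \<noteq> 0}"
    then have d: "total_degree m \<le> d" using assms by (auto simp: deg_le_def)
    then have "lookup m i \<le> d" for i
      using lookup_le_total_degree[of m i] by simp
    then show "set_mset (shape m) \<subseteq> {..d}"
      by (auto simp: set_mset_shape)
    show "size (shape m) \<le> d"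
      using d card_keys_le_total_degree[of m] by (simp add: size_shape)
  qed
  have "{\<mu>. set_mset \<mu> \<subseteq> {..d} \<and> size \<mu> \<le> d} \<subseteq> mset ` {xs. set xs \<subseteq> {..d} \<and> length xs \<le> d}"
  proof
    fix \<mu> assume \<mu>: "\<mu> \<in> {\<mu>. set_mset \<mu> \<subseteq> {..d} \<and> size \<mu> \<le> d}"
    obtain xs where xs: "\<mu> = mset xs" using ex_mset[of \<mu>] by auto
    with \<mu> show "\<mu> \<in> mset ` {xs. set xs \<subseteq> {..d} \<and> length xs \<le> d}"
      by simp
  qed
  then show "finite {\<mu>. set_mset \<mu> \<subseteq> {..d} \<and> size \<mu> \<le> d}"
    by (rule finite_subset) (intro finite_imageI finite_lists_length_le finite_atMost)
qed

text \<open>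
  The induction bounds the monomials of \<open>f\<close> in the lexicographic order of (number of variables, degree),
  coded as a single number; each step removes all leading monomials at once.
\<close>

lemma gGamma_subset_span: "g\<Gamma> \<subseteq> mfps.span (prod_parts p_beta ` \<O>\<P>)"
proof
  fix f assume f: "f \<in> g\<Gamma>"
  then obtain d where "deg_le d f" using gGammaE by blast
  \<comment> \<open>The factor \<open>d + 1\<close> exceeds every degree that occurs, so comparing
    codes is the lexicographic comparison.\<close>
  define code where "code m = card (keys m) * (d + 1) + total_degree m" for m :: monom
  have code_less: "code m < code m'"
    if "card (keys m) < card (keys m') \<or> card (keys m) = card (keys m') \<and> total_degree m < total_degree m'"
      "total_degree m \<le> d" for m m'
    using that(1)
  proof
    assume "card (keys m) < card (keys m')"
    then have "Suc (card (keys m)) * (d + 1) \<le> card (keys m') * (d + 1)"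
      by (intro mult_le_mono1) simp
    then show ?thesis using that(2) by (simp add: code_def)
  qed (simp add: code_def)
  have "f \<in> mfps.span (prod_parts p_beta ` \<O>\<P>)"
    if "f \<in> g\<Gamma>" "deg_le d f" "\<And>m. mcoeff f m \<noteq> 0 \<Longrightarrow> code m < n" for f n
    using that
  proof (induction n arbitrary: f)
    case 0
    then have "f = 0" by (intro mfps_eqI) auto
    then show ?case by (simp add: mfps.span_zero)
  next
    case (Suc n)
    define M where "M = shape ` {m. mcoeff f m \<noteq> 0 \<and> code m = n}"
    define r where "r \<mu> = (SOME m. shape m = \<mu>)" for \<mu>
    \<comment> \<open>By symmetry one representative per shape determines all leading coefficients;
      the divisor is the nonzero leading coefficient of the product.\<close>
    define c where "c \<mu> = mcoeff f (r \<mu>) / mcoeff (prod_parts p_beta \<mu>) (r \<mu>)" for \<mu>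
    define h where "h = (\<Sum>\<mu>\<in>M. mscale (c \<mu>) (prod_parts p_beta \<mu>))"
    have M_fin: "finite M"
      unfolding M_def by (rule finite_subset[OF _ finite_shapes_of_deg_le[OF Suc.prems(2)]]) auto
    have code_shape: "code m = size (shape m) * (d + 1) + \<Sum>\<^sub># (shape m)" for m
      by (simp add: code_def size_shape sum_mset_shape)
    have M_OP: "M \<subseteq> \<O>\<P>"
    proof
      fix \<mu> assume "\<mu> \<in> M"
      then obtain m where m: "mcoeff f m \<noteq> 0" "code m = n" "shape m = \<mu>" by (auto simp: M_def)
      have m': "code m' \<le> code m" "total_degree m' \<le> d" if "mcoeff f m' \<noteq> 0" for m'
        using Suc.prems(2,3) that m(2) by (auto simp: deg_le_def less_Suc_eq_le)
      have "shape m \<in> \<O>\<P>"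
      proof (rule gGamma_leading_odd[OF Suc.prems(1) m(1)])
        fix m' assume nz: "mcoeff f m' \<noteq> 0"
        show "card (keys m') \<le> card (keys m)"
          using code_less[of m m'] m'[OF nz] m'(2)[OF m(1)] by force
        show "total_degree m' \<le> total_degree m" if "card (keys m') = card (keys m)"
          using code_less[of m m'] m'[OF nz] m'(2)[OF m(1)] that by force
      qed
      with m(3) show "\<mu> \<in> \<O>\<P>" by simp
    qed
    have part: "\<mu> \<in> partitions" if "\<mu> \<in> M" for \<mu>
      using M_OP that by (auto simp: odd_partitions_def)
    have r: "shape (r \<mu>) = \<mu>" if "\<mu> \<in> M" for \<mu>
      unfolding r_def using that by (intro someI_ex[of "\<lambda>m. shape m = \<mu>"]) (auto simp: M_def)
    have M_sum: "size \<mu> * (d + 1) + \<Sum>\<^sub># \<mu> = n \<and> \<Sum>\<^sub># \<mu> \<le> d" if "\<mu> \<in> M" for \<mu>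
      using that Suc.prems(2) by (auto simp: M_def code_shape sum_mset_shape deg_le_def)
    have P_gG: "prod_parts p_beta \<mu> \<in> g\<Gamma>" if "\<mu> \<in> M" for \<mu>
      using M_OP that by (intro prod_p_beta_in_gGamma) auto
    have h_span: "h \<in> mfps.span (prod_parts p_beta ` \<O>\<P>)"
      unfolding h_def using M_OP by (intro mfps.span_sum mfps.span_scale mfps.span_base) auto
    have h_gG: "h \<in> g\<Gamma>"
      unfolding h_def
      by (intro mfps.subspace_sum[OF gGamma_subspace] mfps.subspace_scale[OF gGamma_subspace] P_gG)
    \<comment> \<open>No monomial of \<open>h\<close> lies above the leading ones, so the
      subtraction preserves the degree bound and does not raise the maximal code.\<close>
    have h_supp: "\<exists>\<mu>\<in>M. card (keys m) \<le> size \<mu> \<and> total_degree m \<le> \<Sum>\<^sub># \<mu>" if "mcoeff h m \<noteq> 0" for m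
    proof -
      from that obtain \<mu> where "\<mu> \<in> M" "c \<mu> * mcoeff (prod_parts p_beta \<mu>) m \<noteq> 0"
        unfolding h_def mcoeff_sum mcoeff_mscale by (rule sum.not_neutral_contains_not_neutral)
      then show ?thesis using prod_p_beta_support[of \<mu> m] by auto
    qed
    have deg_h: "total_degree m \<le> d \<and> code m \<le> n" if nz: "mcoeff h m \<noteq> 0" for m
    proof -
      obtain \<mu> where \<mu>: "\<mu> \<in> M" "card (keys m) \<le> size \<mu>" "total_degree m \<le> \<Sum>\<^sub># \<mu>"
        using h_supp[OF nz] by blast
      then have "card (keys m) * (d + 1) + total_degree m \<le> size \<mu> * (d + 1) + \<Sum>\<^sub># \<mu>"
        by (intro add_mono mult_le_mono1)
      with M_sum[OF \<mu>(1)] \<mu>(3) show ?thesis by (simp add: code_def)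
    qed
    have "f - h \<in> mfps.span (prod_parts p_beta ` \<O>\<P>)"
    proof (rule Suc.IH)
      show "f - h \<in> g\<Gamma>"
        by (rule mfps.subspace_diff[OF gGamma_subspace Suc.prems(1) h_gG])
      show "deg_le d (f - h)"
        unfolding deg_le_def
      proof (intro allI impI)
        fix m assume "mcoeff (f - h) m \<noteq> 0"
        then have "mcoeff f m \<noteq> 0 \<or> mcoeff h m \<noteq> 0" by (auto simp: mcoeff_diff)
        with Suc.prems(2) deg_h show "total_degree m \<le> d" by (auto simp: deg_le_def)
      qed
      fix m assume nz: "mcoeff (f - h) m \<noteq> 0"
      then have fh: "mcoeff f m \<noteq> 0 \<or> mcoeff h m \<noteq> 0" by (auto simp: mcoeff_diff)
      with Suc.prems(3) deg_h have le: "code m \<le> n" by (auto simp: less_Suc_eq_le)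
      have dm: "total_degree m \<le> d" using fh Suc.prems(2) deg_h by (auto simp: deg_le_def)
      show "code m < n"
      proof (rule ccontr)
        assume "\<not> code m < n"
        with le have code: "code m = n" by simp
        \<comment> \<open>Different shapes of equal code have the same number of parts and the same
          size, so by triangularity they do not interfere.\<close>
        have other: "mcoeff (prod_parts p_beta \<mu>) m = 0" if \<mu>: "\<mu> \<in> M" "shape m \<noteq> \<mu>" for \<mu>
        proof -
          have "code m = code (r \<mu>)" "total_degree (r \<mu>) \<le> d"
            using M_sum[OF \<mu>(1)] code r[OF \<mu>(1)] by (auto simp: code_shape sum_mset_shape[symmetric])
          then have "card (keys m) = card (keys (r \<mu>)) \<and> total_degree m = total_degree (r \<mu>)"
            using code_less[of m "r \<mu>"] code_less[of "r \<mu>" m] dm by force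
          then show ?thesis
            using r[OF \<mu>(1)] size_shape[of "r \<mu>"] sum_mset_shape[of "r \<mu>"]
            by (intro prod_p_beta_leading_other part \<mu>) auto
        qed
        have "mcoeff h m = mcoeff f m"
        proof (cases "shape m \<in> M")
          case True
          have sh: "shape (r (shape m)) = shape m" using r[OF True] .
          have "mcoeff h m = (\<Sum>\<mu>\<in>M. if \<mu> = shape m then c \<mu> * mcoeff (prod_parts p_beta \<mu>) m else 0)"
            unfolding h_def mcoeff_sum mcoeff_mscale by (rule sum.cong) (auto simp: other)
          also have "\<dots> = c (shape m) * mcoeff (prod_parts p_beta (shape m)) m"
            using True M_fin by simp
          also have "mcoeff (prod_parts p_beta (shape m)) m = mcoeff (prod_parts p_beta (shape m)) (r (shape m))"
            using P_gG[OF True] sh by (metis gGammaE symmetric_mcoeff_eq)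
          also have "c (shape m) * \<dots> = mcoeff f (r (shape m))"
            using prod_p_beta_leading_nonzero[OF part[OF True] sh] by (simp add: c_def)
          also have "\<dots> = mcoeff f m"
            using Suc.prems(1) sh by (metis gGammaE symmetric_mcoeff_eq)
          finally show ?thesis .
        next
          case False
          then have "mcoeff f m = 0" using code by (auto simp: M_def)
          moreover have "mcoeff h m = 0"
            unfolding h_def mcoeff_sum mcoeff_mscale
            by (rule sum.neutral) (use False other in auto)
          ultimately show ?thesis by simp
        qed
        with nz show False by (simp add: mcoeff_diff)
      qed
    qed
    from mfps.span_add[OF this h_span] show ?case by simp
  qed
  \<comment> \<open>Each variable adds at least 1 to the degree, so number of variables and degree
    are both at most \<open>d\<close>.\<close>
  moreover have "code m < d * (d + 1) + d + 1" if "mcoeff f m \<noteq> 0" for m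
  proof -
    have "total_degree m \<le> d" using \<open>deg_le d f\<close> that by (auto simp: deg_le_def)
    moreover from this have "card (keys m) * (d + 1) \<le> d * (d + 1)"
      using card_keys_le_total_degree[of m] by (intro mult_le_mono1) simp
    ultimately show ?thesis by (simp add: code_def)
  qed
  ultimately show "f \<in> mfps.span (prod_parts p_beta ` \<O>\<P>)"
    using f \<open>deg_le d f\<close> by blast
qed

lemma span_prod_p_beta: "mfps.span (prod_parts p_beta ` \<O>\<P>) = g\<Gamma>"
proof
  show "mfps.span (prod_parts p_beta ` \<O>\<P>) \<subseteq> g\<Gamma>"
    by (rule mfps.span_minimal) (auto intro: prod_p_beta_in_gGamma gGamma_subspace)
qed (rule gGamma_subset_span)

text \<open>Two indices with the same vector violate the premise with coefficients \<open>1\<close>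
  and \<open>- 1\<close>; a linear dependence violates it once its zero coefficients are
  dropped.\<close>

lemma independent_familyI:
  assumes "\<And>T u. finite T \<Longrightarrow> T \<subseteq> I \<Longrightarrow> T \<noteq> {} \<Longrightarrow> (\<And>i. i \<in> T \<Longrightarrow> u i \<noteq> 0) \<Longrightarrow>
    (\<Sum>i\<in>T. mscale (u i) (b i)) \<noteq> 0"
  shows "inj_on b I" "mfps.independent (b ` I)"
proof -
  show inj: "inj_on b I"
  proof (rule inj_onI, rule ccontr)
    fix i j assume ij: "i \<in> I" "j \<in> I" "b i = b j" "i \<noteq> j"
    have "(\<Sum>l\<in>{i, j}. mscale ((\<lambda>l. if l = i then 1 else - 1) l) (b l)) = 0"
      using ij by (intro mfps_eqI) (simp add: mcoeff_add mcoeff_mscale)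
    moreover have "(\<Sum>l\<in>{i, j}. mscale ((\<lambda>l. if l = i then 1 else - 1) l) (b l)) \<noteq> 0"
      using ij by (intro assms) auto
    ultimately show False by contradiction
  qed
  show "mfps.independent (b ` I)"
  proof
    assume "mfps.dependent (b ` I)"
    then obtain S v w where S: "finite S" "S \<subseteq> b ` I" "(\<Sum>x\<in>S. mscale (v x) x) = 0" "w \<in> S" "v w \<noteq> 0"
      unfolding mfps.dependent_explicit by blast
    define T where "T = {i \<in> I. b i \<in> S \<and> v (b i) \<noteq> 0}"
    have inj_T: "inj_on b T" using inj by (rule inj_on_subset) (auto simp: T_def)
    have bT: "b ` T = {x \<in> S. v x \<noteq> 0}" using S(2) by (auto simp: T_def)
    have "finite (b ` T)" unfolding bT using S(1) by simp
    then have "finite T" using inj_T by (rule finite_imageD)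
    moreover have "T \<noteq> {}" using bT S(4,5) by auto
    ultimately have "(\<Sum>i\<in>T. mscale ((v \<circ> b) i) (b i)) \<noteq> 0"
      by (intro assms) (auto simp: T_def)
    also have "(\<Sum>i\<in>T. mscale ((v \<circ> b) i) (b i)) = (\<Sum>x\<in>b ` T. mscale (v x) x)"
      by (simp add: sum.reindex[OF inj_T])
    also have "\<dots> = (\<Sum>x\<in>S. mscale (v x) x)"
      unfolding bT by (rule sum.mono_neutral_left) (use S(1) in \<open>auto\<close>)
    finally show False using S(3) by simp
  qed
qed

text \<open>Among the partitions of a combination take \<nu> with the most parts and, among these,
  of largest size: at a monomial of shape \<nu> only its own term survives.\<close>

lemma prod_p_beta_independent:
  "inj_on (prod_parts p_beta) \<O>\<P>" "mfps.independent (prod_parts p_beta ` \<O>\<P>)"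
proof -
  have *: "(\<Sum>\<mu>\<in>T. mscale (u \<mu>) (prod_parts p_beta \<mu>)) \<noteq> 0"
    if T: "finite T" "T \<subseteq> \<O>\<P>" "T \<noteq> {}" and u: "\<And>\<mu>. \<mu> \<in> T \<Longrightarrow> u \<mu> \<noteq> 0" for T u
  proof
    assume zero: "(\<Sum>\<mu>\<in>T. mscale (u \<mu>) (prod_parts p_beta \<mu>)) = 0"
    have part: "\<mu> \<in> partitions" if "\<mu> \<in> T" for \<mu>
      using T that by (auto simp: odd_partitions_def)
    define T' where "T' = {\<mu> \<in> T. size \<mu> = Max (size ` T)}"
    have "Max (size ` T) \<in> size ` T" using T by (intro Max_in) auto
    then have T': "finite T'" "T' \<noteq> {}" using T(1) by (auto simp: T'_def image_iff)
    then have "Max (sum_mset ` T') \<in> sum_mset ` T'" by (intro Max_in) auto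
    then obtain \<nu> where \<nu>: "\<nu> \<in> T'" "\<Sum>\<^sub># \<nu> = Max (sum_mset ` T')" by auto
    then have \<nu>_T: "\<nu> \<in> T" by (simp add: T'_def)
    obtain m where m: "shape m = \<nu>"
      using ex_shape_avoiding[OF part[OF \<nu>_T] finite.emptyI] by blast
    have other: "mcoeff (prod_parts p_beta \<mu>) m = 0" if \<mu>: "\<mu> \<in> T" "\<mu> \<noteq> \<nu>" for \<mu>
    proof (rule prod_p_beta_leading_other[OF part[OF \<mu>(1)]])
      have size_m: "card (keys m) = Max (size ` T)"
        using \<nu>(1) m size_shape[of m] by (simp add: T'_def)
      show "size \<mu> \<le> card (keys m)"
        unfolding size_m using T \<mu>(1) by (intro Max_ge) auto
      show "\<Sum>\<^sub># \<mu> \<le> total_degree m" if "size \<mu> = card (keys m)"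
      proof -
        have "\<mu> \<in> T'" using that \<mu>(1) size_m by (simp add: T'_def)
        then have "\<Sum>\<^sub># \<mu> \<le> Max (sum_mset ` T')" using T' by (intro Max_ge) auto
        then show ?thesis using \<nu>(2) m sum_mset_shape[of m] by simp
      qed
      show "shape m \<noteq> \<mu>" using m \<mu>(2) by simp
    qed
    have "0 = mcoeff (\<Sum>\<mu>\<in>T. mscale (u \<mu>) (prod_parts p_beta \<mu>)) m"
      by (simp add: zero)
    also have "\<dots> = (\<Sum>\<mu>\<in>T. if \<mu> = \<nu> then u \<nu> * mcoeff (prod_parts p_beta \<nu>) m else 0)"
      unfolding mcoeff_sum mcoeff_mscale by (rule sum.cong) (auto simp: other)
    also have "\<dots> = u \<nu> * mcoeff (prod_parts p_beta \<nu>) m"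
      using T(1) \<nu>_T by simp
    finally show False
      using u[OF \<nu>_T] prod_p_beta_leading_nonzero[OF part[OF \<nu>_T] m] by simp
  qed
  show "inj_on (prod_parts p_beta) \<O>\<P>" "mfps.independent (prod_parts p_beta ` \<O>\<P>)"
    using independent_familyI[OF *] by blast+
qed

section \<open>Filtration by the size of partitions\<close>

text \<open>Because the bound is strict, \<open>level s I (Suc n)\<close> holds size at most
  \<open>n\<close>, and congruence modulo smaller sizes means that a difference lies in
  \<open>level s I n\<close>.\<close>

definition level :: "(nat \<Rightarrow> qbeta mfps) \<Rightarrow> nat multiset set \<Rightarrow> nat \<Rightarrow> qbeta mfps set" where
  "level s I n = mfps.span (prod_parts s ` {\<mu> \<in> I. \<Sum>\<^sub># \<mu> < n})"

lemma level_subspace: "mfps.subspace (level s I n)"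
  by (simp add: level_def mfps.subspace_span)

lemmas level_add = mfps.subspace_add[OF level_subspace]
lemmas level_diff = mfps.subspace_diff[OF level_subspace]
lemmas level_sum = mfps.subspace_sum[OF level_subspace]
lemmas level_scale = mfps.subspace_scale[OF level_subspace]
lemmas level_zero = mfps.subspace_0[OF level_subspace]

lemma level_base: "\<mu> \<in> I \<Longrightarrow> \<Sum>\<^sub># \<mu> < n \<Longrightarrow> prod_parts s \<mu> \<in> level s I n"
  unfolding level_def by (rule mfps.span_base) auto

lemma level_least:
  assumes "mfps.subspace V" "\<And>\<mu>. \<mu> \<in> I \<Longrightarrow> \<Sum>\<^sub># \<mu> < n \<Longrightarrow> prod_parts s \<mu> \<in> V"
  shows "level s I n \<subseteq> V"
  unfolding level_def using assms by (intro mfps.span_minimal) auto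

lemma level_mono: "m \<le> n \<Longrightarrow> level s I m \<subseteq> level s I n"
  by (rule level_least[OF level_subspace]) (auto intro: level_base)

lemma level_monoD: "x \<in> level s I m \<Longrightarrow> m \<le> n \<Longrightarrow> x \<in> level s I n"
  using level_mono by blast

text \<open>Joining the parts preserves odd partitions but not strict ones; multiplicativity of
  levels is therefore used only for the former.\<close>

definition add_closed :: "nat multiset set \<Rightarrow> bool" where
  "add_closed I \<longleftrightarrow> {#} \<in> I \<and> (\<forall>\<mu>\<in>I. \<forall>\<nu>\<in>I. \<mu> + \<nu> \<in> I)"

lemma add_closed_OP: "add_closed \<O>\<P>"
  by (auto simp: add_closed_def odd_partitions_def partitions_def)

lemma subspace_vimage_mult: "mfps.subspace V \<Longrightarrow> mfps.subspace {x. x * y \<in> V}"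
  by (rule mfps.subspaceI)
    (auto simp: distrib_right mscale_mult_left mfps.subspace_0 mfps.subspace_add mfps.subspace_scale)

text \<open>Size at most \<open>a\<close> and size below \<open>b\<close> add up to size below
  \<open>a + b\<close>: an error term stays an error term after multiplication by a factor of full
  size.\<close>

lemma level_mult:
  assumes I: "add_closed I" and x: "x \<in> level s I (Suc a)" and y: "y \<in> level s I b"
  shows "x * y \<in> level s I (a + b)"
proof -
  have base: "prod_parts s \<mu> * y \<in> level s I (a + b)" if \<mu>: "\<mu> \<in> I" "\<Sum>\<^sub># \<mu> < Suc a" for \<mu>
  proof -
    have "level s I b \<subseteq> {y. y * prod_parts s \<mu> \<in> level s I (a + b)}"
    proof (rule level_least[OF subspace_vimage_mult[OF level_subspace]])
      fix \<nu> assume "\<nu> \<in> I" "\<Sum>\<^sub># \<nu> < b"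
      then show "prod_parts s \<nu> \<in> {y. y * prod_parts s \<mu> \<in> level s I (a + b)}"
        using I \<mu> unfolding mem_Collect_eq prod_parts_union[symmetric]
        by (intro level_base) (auto simp: add_closed_def)
    qed
    with y show ?thesis by (auto simp: mult.commute)
  qed
  have "level s I (Suc a) \<subseteq> {x. x * y \<in> level s I (a + b)}"
    by (rule level_least[OF subspace_vimage_mult[OF level_subspace]]) (use base in auto)
  with x show ?thesis by blast
qed

lemma level_mult_Suc:
  assumes "add_closed I" "x \<in> level s I (Suc a)" "y \<in> level s I (Suc b)" "a + b \<le> n"
  shows "x * y \<in> level s I (Suc n)"
  using level_mult[OF assms(1-3)] assms(4) by (auto intro: level_monoD)

lemma level_one: "add_closed I \<Longrightarrow> 1 \<in> level s I (Suc n)"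
  using level_base[of "{#}" I "Suc n" s] by (simp add: add_closed_def)

lemma prod_parts_in_level:
  assumes I: "add_closed I" and "\<And>k. k \<in># \<mu> \<Longrightarrow> s k \<in> level t I (Suc k)"
  shows "prod_parts s \<mu> \<in> level t I (Suc (\<Sum>\<^sub># \<mu>))"
  using assms(2)
proof (induction \<mu>)
  case (add k \<mu>)
  then show ?case by (auto intro!: level_mult_Suc[OF I])
qed (simp add: level_one[OF I])

lemma independent_family_of_card_le:
  assumes "finite J" "inj_on b I" "mfps.independent (b ` I)" "b ` I \<subseteq> mfps.span (s ` J)" "card J \<le> card I"
  shows "inj_on s J" "mfps.independent (s ` J)"
proof -
  have fin: "finite (s ` J)" using assms(1) by simp
  obtain B where B: "B \<subseteq> s ` J" "mfps.independent B" "s ` J \<subseteq> mfps.span B"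
    by (rule mfps.maximal_independent_subset)
  have "finite B" using B(1) fin by (rule finite_subset)
  have "b ` I \<subseteq> mfps.span B"
    using assms(4) mfps.span_minimal[OF B(3) mfps.subspace_span] by blast
  then have "card (b ` I) \<le> card B"
    using mfps.independent_span_bound[OF \<open>finite B\<close> assms(3)] by blast
  then have "card J \<le> card B" using assms(2,5) by (simp add: card_image)
  moreover have "card B \<le> card (s ` J)" using B(1) fin by (rule card_mono[rotated])
  moreover have "card (s ` J) \<le> card J" using assms(1) by (rule card_image_le)
  ultimately have eq: "card B = card (s ` J)" "card (s ` J) = card J" by auto
  show "inj_on s J" using eq(2) assms(1) by (simp add: eq_card_imp_inj_on)
  have "B = s ` J" using B(1) eq(1) fin by (simp add: card_subset_eq)
  with B(2) show "mfps.independent (s ` J)" by simp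
qed

lemma finite_partitions_less: "finite {\<mu> \<in> partitions. \<Sum>\<^sub># \<mu> < n}"
proof (rule finite_subset)
  show "{\<mu> \<in> partitions. \<Sum>\<^sub># \<mu> < n} \<subseteq> mset ` {xs. set xs \<subseteq> {..n} \<and> length xs \<le> n}"
  proof
    fix \<mu> assume \<mu>: "\<mu> \<in> {\<mu> \<in> partitions. \<Sum>\<^sub># \<mu> < n}"
    \<comment> \<open>A monomial of this shape lets the degree bounds on exponents and number of
      variables apply.\<close>
    obtain m where m: "shape m = \<mu>" using \<mu> ex_shape_avoiding[of \<mu> "{}"] by auto
    have d: "total_degree m < n" using \<mu> m sum_mset_shape[of m] by auto
    obtain xs where xs: "\<mu> = mset xs" using ex_mset[of \<mu>] by auto
    have "size \<mu> \<le> n" using d m size_shape[of m] card_keys_le_total_degree[of m] by simp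
    moreover have "lookup m i \<le> n" for i using lookup_le_total_degree[of m i] d by simp
    then have "set_mset \<mu> \<subseteq> {..n}" using m set_mset_shape[of m] by auto
    ultimately show "\<mu> \<in> mset ` {xs. set xs \<subseteq> {..n} \<and> length xs \<le> n}"
      using xs by simp
  qed
  show "finite (mset ` {xs. set xs \<subseteq> {..n} \<and> length xs \<le> n})"
    by (intro finite_imageI finite_lists_length_le finite_atMost)
qed

text \<open>
  One half of Euler's theorem: a part \<open>2\<^sup>a b\<close> with \<open>b\<close> odd is split into \<open>2\<^sup>a\<close> copies of \<open>b\<close>, and
  the strict partition is recovered from the binary expansions of the multiplicities.
\<close>

lemma card_strict_le_card_odd:
  "card {\<mu> \<in> \<S>\<P>. \<Sum>\<^sub># \<mu> < n} \<le> card {\<mu> \<in> \<O>\<P>. \<Sum>\<^sub># \<mu> < n}"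
proof -
  have "\<exists>p. odd (snd p) \<and> i = 2 ^ fst p * snd p" if i: "i > 0" for i :: nat
  proof -
    obtain x where "i = 2 ^ multiplicity 2 i * x" "\<not> 2 dvd x"
      by (rule multiplicity_decompose'[of i 2]) (use i in auto)
    then show ?thesis by (intro exI[of _ "(multiplicity 2 i, x)"]) auto
  qed
  then have "\<forall>i. \<exists>p. i > 0 \<longrightarrow> odd (snd p) \<and> (i :: nat) = 2 ^ fst p * snd p" by blast
  from choice[OF this] obtain f :: "nat \<Rightarrow> nat \<times> nat"
    where f: "\<And>i. i > 0 \<Longrightarrow> odd (snd (f i)) \<and> i = 2 ^ fst (f i) * snd (f i)" by blast
  define v w where "v i = fst (f i)" and "w i = snd (f i)" for i
  have w: "odd (w i)" and vw: "2 ^ v i * w i = i" if "i > 0" for i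
    using f[OF that] by (auto simp: v_def w_def)
  define \<phi> where "\<phi> \<mu> = (\<Sum>i\<in>#\<mu>. replicate_mset (2 ^ v i) (w i))" for \<mu>
  have sum: "\<Sum>\<^sub># (\<phi> \<mu>) = \<Sum>\<^sub># \<mu>" if "\<mu> \<in> partitions" for \<mu>
    using that
  proof (induction \<mu>)
    case (add k \<mu>)
    then show ?case by (auto simp: \<phi>_def add_mset_partitions vw)
  qed (simp add: \<phi>_def)
  have odd: "\<phi> \<mu> \<in> \<O>\<P>" if "\<mu> \<in> partitions" for \<mu>
    using that
  proof (induction \<mu>)
    case (add k \<mu>)
    have "replicate_mset (2 ^ v k) (w k) \<in> \<O>\<P>"
      using w[of k] add.prems
      by (auto simp: odd_partitions_def partitions_def add_mset_partitions intro: gr0I split: if_splits)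
    moreover have "\<phi> \<mu> \<in> \<O>\<P>" using add by (simp add: add_mset_partitions)
    ultimately show ?case using add_closed_OP by (simp add: \<phi>_def add_closed_def)
  qed (simp add: \<phi>_def odd_partitions_def partitions_def)
  have SP: "\<mu> = mset_set (set_mset \<mu>)" if "\<mu> \<in> \<S>\<P>" for \<mu>
    by (rule multiset_eqI) (use that in \<open>auto simp: strict_partitions_def count_mset_set' not_in_iff\<close>)
  have pos: "i > 0" if "\<mu> \<in> \<S>\<P>" "i \<in># \<mu>" for i \<mu>
    using that by (auto simp: strict_partitions_def partitions_def intro: gr0I)
  have vw_eq: "i = j" if "v i = v j" "w i = w j" "i > 0" "j > 0" for i j
    by (subst vw[OF that(3), symmetric], subst vw[OF that(4), symmetric]) (simp only: that)
  \<comment> \<open>Distinct parts with the same odd factor \<open>b\<close> have distinct exponents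
    \<open>v i\<close>; these are the binary digits of the multiplicity of \<open>b\<close>, and
    \<open>set_encode\<close> is injective on finite sets.\<close>
  have count: "count (\<phi> \<mu>) b = set_encode (v ` {i \<in> set_mset \<mu>. w i = b})" if \<mu>: "\<mu> \<in> \<S>\<P>" for \<mu> b
  proof -
    have inj: "inj_on v {i \<in> set_mset \<mu>. w i = b}"
      by (rule inj_onI, rule vw_eq) (simp_all add: pos[OF \<mu>])
    have "count (\<phi> \<mu>) b = (\<Sum>i\<in>set_mset \<mu>. if w i = b then 2 ^ v i else 0)"
      unfolding \<phi>_def by (subst SP[OF \<mu>]) (simp add: sum_unfold_sum_mset[symmetric] count_sum eq_commute[of b])
    also have "\<dots> = (\<Sum>i\<in>{i \<in> set_mset \<mu>. w i = b}. 2 ^ v i)"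
      by (rule sum.inter_filter[symmetric]) simp
    finally show ?thesis
      by (simp add: set_encode_def sum.reindex[OF inj])
  qed
  have sub: "set_mset \<mu> \<subseteq> set_mset \<nu>" if \<mu>: "\<mu> \<in> \<S>\<P>" and \<nu>: "\<nu> \<in> \<S>\<P>" and eq: "\<phi> \<mu> = \<phi> \<nu>" for \<mu> \<nu>
  proof
    fix i assume i: "i \<in># \<mu>"
    have "set_encode (v ` {j \<in> set_mset \<mu>. w j = w i}) = set_encode (v ` {j \<in> set_mset \<nu>. w j = w i})"
      by (simp only: count[OF \<mu>, symmetric] count[OF \<nu>, symmetric] eq)
    then have *: "v ` {j \<in> set_mset \<mu>. w j = w i} = v ` {j \<in> set_mset \<nu>. w j = w i}"
      by (simp add: set_encode_eq)
    have "v i \<in> v ` {j \<in> set_mset \<mu>. w j = w i}" using i by (intro imageI) simp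
    then obtain j where j: "j \<in># \<nu>" "w j = w i" "v i = v j" unfolding * by auto
    from vw_eq[OF j(3) j(2)[symmetric] pos[OF \<mu> i] pos[OF \<nu> j(1)]] j(1) show "i \<in># \<nu>" by simp
  qed
  show ?thesis
  proof (rule card_inj_on_le[of \<phi>])
    show "inj_on \<phi> {\<mu> \<in> \<S>\<P>. \<Sum>\<^sub># \<mu> < n}"
    proof (rule inj_onI)
      fix \<mu> \<nu> assume "\<mu> \<in> {\<mu> \<in> \<S>\<P>. \<Sum>\<^sub># \<mu> < n}" "\<nu> \<in> {\<mu> \<in> \<S>\<P>. \<Sum>\<^sub># \<mu> < n}" and eq: "\<phi> \<mu> = \<phi> \<nu>"
      then have *: "\<mu> \<in> \<S>\<P>" "\<nu> \<in> \<S>\<P>" by auto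
      then have "set_mset \<mu> = set_mset \<nu>" using sub eq by (intro equalityI) auto
      then have "mset_set (set_mset \<mu>) = mset_set (set_mset \<nu>)" by simp
      then show "\<mu> = \<nu>" by (simp only: SP[OF *(1), symmetric] SP[OF *(2), symmetric])
    qed
    show "\<phi> ` {\<mu> \<in> \<S>\<P>. \<Sum>\<^sub># \<mu> < n} \<subseteq> {\<mu> \<in> \<O>\<P>. \<Sum>\<^sub># \<mu> < n}"
      using odd sum by (auto simp: strict_partitions_def)
    show "finite {\<mu> \<in> \<O>\<P>. \<Sum>\<^sub># \<mu> < n}"
      by (rule finite_subset[OF _ finite_partitions_less[of n]]) (auto simp: odd_partitions_def)
  qed
qed

text \<open>On each finite-dimensional level the dimension count turns spanning into independence;
  independence and injectivity then pass to the increasing union.\<close>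

lemma basis_of_levels:
  assumes J: "J \<subseteq> partitions"
    and card: "\<And>n. card {\<mu> \<in> J. \<Sum>\<^sub># \<mu> < n} \<le> card {\<mu> \<in> \<O>\<P>. \<Sum>\<^sub># \<mu> < n}"
    and lev: "\<And>n. level s J n = level p_beta \<O>\<P> n"
  shows "is_basis_family (prod_parts s) J g\<Gamma>"
proof -
  let ?J = "\<lambda>n. {\<mu> \<in> J. \<Sum>\<^sub># \<mu> < n}"
  let ?P = "prod_parts s"
  have "inj_on ?P (?J n) \<and> mfps.independent (?P ` ?J n)" for n
  proof -
    let ?O = "{\<mu> \<in> \<O>\<P>. \<Sum>\<^sub># \<mu> < n}"
    have fin: "finite (?J n)"
      by (rule finite_subset[OF _ finite_partitions_less[of n]]) (use J in auto)
    have inj: "inj_on (prod_parts p_beta) ?O"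
      by (rule inj_on_subset[OF prod_p_beta_independent(1)]) auto
    have ind: "mfps.independent (prod_parts p_beta ` ?O)"
      by (rule mfps.independent_mono[OF prod_p_beta_independent(2)]) auto
    have "prod_parts p_beta ` ?O \<subseteq> mfps.span (?P ` ?J n)"
      using lev[of n] level_base[of _ "\<O>\<P>" n p_beta] by (auto simp: level_def[of s])
    from independent_family_of_card_le[OF fin inj ind this card] show ?thesis by blast
  qed
  then have inj_n: "inj_on ?P (?J n)" and ind_n: "mfps.independent (?P ` ?J n)" for n by auto
  have "inj_on ?P J"
  proof (rule inj_onI)
    fix \<mu> \<nu> assume "\<mu> \<in> J" "\<nu> \<in> J" "?P \<mu> = ?P \<nu>"
    then show "\<mu> = \<nu>"
      by (intro inj_onD[OF inj_n[of "Suc (\<Sum>\<^sub># \<mu> + \<Sum>\<^sub># \<nu>)"]]) auto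
  qed
  moreover have "mfps.independent (\<Union> (range (\<lambda>n. ?P ` ?J n)))"
  proof (rule mfps.independent_Union_directed)
    fix c d assume "c \<in> range (\<lambda>n. ?P ` ?J n)" "d \<in> range (\<lambda>n. ?P ` ?J n)"
    then obtain m n where mn: "c = ?P ` ?J m" "d = ?P ` ?J n" by blast
    then show "c \<subseteq> d \<or> d \<subseteq> c" by (cases "m \<le> n") (auto intro!: image_mono)
  qed (use ind_n in auto)
  moreover have "\<Union> (range (\<lambda>n. ?P ` ?J n)) = ?P ` J" by auto
  moreover have "mfps.span (?P ` J) = g\<Gamma>"
  proof
    show "mfps.span (?P ` J) \<subseteq> g\<Gamma>"
    proof (rule mfps.span_minimal[OF _ gGamma_subspace], rule image_subsetI)
      fix \<mu> assume "\<mu> \<in> J"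
      then have "?P \<mu> \<in> level p_beta \<O>\<P> (Suc (\<Sum>\<^sub># \<mu>))"
        unfolding lev[symmetric] by (rule level_base) simp
      then show "?P \<mu> \<in> g\<Gamma>"
        using level_least[OF gGamma_subspace, of "\<O>\<P>" _ p_beta] prod_p_beta_in_gGamma by blast
    qed
    have "prod_parts p_beta \<mu> \<in> mfps.span (?P ` J)" if "\<mu> \<in> \<O>\<P>" for \<mu>
    proof -
      have "prod_parts p_beta \<mu> \<in> level s J (Suc (\<Sum>\<^sub># \<mu>))"
        unfolding lev using that by (rule level_base) simp
      also have "\<dots> \<subseteq> mfps.span (?P ` J)"
        unfolding level_def by (rule mfps.span_mono) auto
      finally show ?thesis .
    qed
    then show "g\<Gamma> \<subseteq> mfps.span (?P ` J)"
      unfolding span_prod_p_beta[symmetric] by (intro mfps.span_minimal mfps.subspace_span) auto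
  qed
  ultimately show ?thesis by (simp add: is_basis_family_def)
qed

section \<open>Sequences with classical leading terms\<close>

text \<open>The coefficient of \<open>z^(k-1)\<close> in the logarithmic derivative of the series of
  \<open>schur_q\<close>; classically twice the \<open>k\<close>-th power sum for odd
  \<open>k\<close>.\<close>

definition newton_coeff :: "nat \<Rightarrow> qbeta mfps" where
  "newton_coeff k = (if odd k then mscale 2 (p_beta k) else 0)"

text \<open>
  The coefficients of \<open>exp (2 \<Sum>\<^sub>k p_beta k w\<^sup>k / k)\<close>, the sum ranging over odd \<open>k\<close>: the functions
  \<open>q\<^sub>n\<close> of Schur in terms of power sums, with \<open>p_beta\<close> in place of the power sums.
\<close>

fun schur_q :: "nat \<Rightarrow> qbeta mfps" where
  "schur_q 0 = 1"
| "schur_q (Suc n) = mscale (1 / of_nat (Suc n)) (\<Sum>k\<le>n. newton_coeff (Suc n - k) * schur_q k)"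

lemma schur_q_newton: "of_nat n * schur_q n = (\<Sum>k<n. newton_coeff (n - k) * schur_q k)"
proof (cases n)
  case (Suc m)
  have "of_nat (Suc m) * schur_q (Suc m) = (\<Sum>k\<le>m. newton_coeff (Suc m - k) * schur_q k)"
    unfolding mscale_of_nat[symmetric] by (simp del: of_nat_Suc)
  then show ?thesis by (simp add: Suc lessThan_Suc_atMost del: of_nat_Suc)
qed simp

lemma of_nat_mult_eq_0: "of_nat (Suc n) * (x :: qbeta mfps) = 0 \<Longrightarrow> x = 0"
  unfolding mscale_of_nat[symmetric] by (simp del: of_nat_Suc)

lemma level_of_nat_mult:
  assumes "of_nat (Suc n) * x \<in> level s I m"
  shows "x \<in> level s I m"
proof -
  have "mscale (1 / of_nat (Suc n)) (of_nat (Suc n) * x) \<in> level s I m"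
    using assms by (rule level_scale)
  then show ?thesis unfolding mscale_of_nat[symmetric] by (simp del: of_nat_Suc)
qed

text \<open>For \<open>H(z) = \<Sum>\<^sub>n schur_q n z\<^sup>n\<close> the logarithmic derivative is even, hence \<open>H(z) H(-z) = 1\<close>.\<close>

lemma schur_q_relation:
  assumes "N > 0"
  shows "(\<Sum>i=0..N. schur_q i * ((-1) ^ (N - i) * schur_q (N - i))) = 0"
proof -
  define H where "H = Abs_fps schur_q"
  define H' where "H' = Abs_fps (\<lambda>n. (-1) ^ n * schur_q n)"
  define L where "L = Abs_fps (\<lambda>n. newton_coeff (Suc n))"
  have newton: "of_nat (Suc n) * schur_q (Suc n) = (\<Sum>i=0..n. newton_coeff (Suc i) * schur_q (n - i))" for n
    unfolding schur_q_newton
    by (rule sum.reindex_bij_witness[where i = "\<lambda>i. n - i" and j = "\<lambda>k. n - k"]) (auto simp: Suc_diff_le)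
  have H: "fps_deriv H = L * H"
    by (rule fps_ext) (simp add: H_def L_def fps_mult_nth newton[simplified])
  have "fps_deriv H' = - (L * H')"
  proof (rule fps_ext)
    fix n
    have "fps_deriv H' $ n = (-1) ^ Suc n * (of_nat (Suc n) * schur_q (Suc n))"
      by (simp add: H'_def mult_ac)
    also have "\<dots> = (\<Sum>i=0..n. (-1) ^ Suc n * (newton_coeff (Suc i) * schur_q (n - i)))"
      by (simp only: newton sum_distrib_left)
    \<comment> \<open>Only even \<open>i\<close> contribute, as \<open>newton_coeff\<close> vanishes
      at even arguments; for these \<open>(-1)^n = (-1)^(n - i)\<close>.\<close>
    also have "\<dots> = (\<Sum>i=0..n. - (newton_coeff (Suc i) * ((-1) ^ (n - i) * schur_q (n - i))))"
    proof (rule sum.cong[OF refl])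
      fix i assume i: "i \<in> {0..n}"
      show "(-1) ^ Suc n * (newton_coeff (Suc i) * schur_q (n - i)) =
          - (newton_coeff (Suc i) * ((-1) ^ (n - i) * schur_q (n - i)))"
      proof (cases "even i")
        case True
        then have "even n = even (n - i)" using i by auto
        then have "(-1) ^ n = ((-1) ^ (n - i) :: qbeta mfps)" by (auto simp: minus_one_power_iff)
        then show ?thesis by (simp add: mult_ac)
      qed (simp add: newton_coeff_def)
    qed
    also have "\<dots> = (- (L * H')) $ n"
      by (simp add: L_def H'_def fps_mult_nth sum_negf)
    finally show "fps_deriv H' $ n = (- (L * H')) $ n" .
  qed
  then have "fps_deriv (H * H') = 0"
    by (simp add: H algebra_simps)
  then have "fps_deriv (H * H') $ (N - 1) = 0" by simp
  then have "of_nat (Suc (N - 1)) * (H * H') $ Suc (N - 1) = 0"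
    by (simp only: fps_deriv_nth Suc_eq_plus1)
  then have "(H * H') $ N = 0"
    using of_nat_mult_eq_0 assms by (metis Suc_pred')
  then show ?thesis by (simp add: H_def H'_def fps_mult_nth)
qed

text \<open>In the relation for \<open>2 * a\<close> the term \<open>i = a\<close> is the square up
  to sign, and \<open>i\<close> and \<open>2 * a - i\<close> give the same product, so indices below
  \<open>a\<close> suffice. Index 0 stands for \<open>schur_q (2 * a)\<close> alone.\<close>

lemma schur_q_square:
  assumes "a > 0"
  shows "schur_q a * schur_q a \<in> mfps.span ((\<lambda>i. schur_q i * schur_q (2 * a - i)) ` {..<a})"
proof -
  let ?V = "mfps.span ((\<lambda>i. schur_q i * schur_q (2 * a - i)) ` {..<a})"
  let ?t = "\<lambda>i. schur_q i * ((-1) ^ (2 * a - i) * schur_q (2 * a - i))"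
  have sign: "(-1) ^ n * x \<in> ?V \<longleftrightarrow> x \<in> ?V" for n :: nat and x :: "qbeta mfps"
    by (cases "even n") (auto simp: mfps.span_neg dest: mfps.span_neg)
  have t: "?t i = (-1) ^ (2 * a - i) * (schur_q i * schur_q (2 * a - i))" for i
    by (simp add: mult_ac)
  have mem: "schur_q i * schur_q (2 * a - i) \<in> ?V" if "i \<in> {0..2 * a} - {a}" for i
  proof (cases "i < a")
    case False
    then have "schur_q (2 * a - i) * schur_q (2 * a - (2 * a - i)) \<in> ?V"
      using that by (intro mfps.span_base image_eqI[of _ _ "2 * a - i"]) auto
    moreover have "2 * a - (2 * a - i) = i" using that by simp
    ultimately show ?thesis by (simp add: mult.commute)
  qed (auto intro: mfps.span_base)
  have "(\<Sum>i\<in>{0..2 * a}. ?t i) = ?t a + (\<Sum>i\<in>{0..2 * a} - {a}. ?t i)"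
    by (rule sum.remove) auto
  then have "?t a = - (\<Sum>i\<in>{0..2 * a} - {a}. ?t i)"
    using schur_q_relation[of "2 * a"] assms by (simp add: eq_neg_iff_add_eq_0)
  moreover have "(\<Sum>i\<in>{0..2 * a} - {a}. ?t i) \<in> ?V"
    unfolding t by (intro mfps.span_sum) (simp only: sign mem)
  ultimately have "?t a \<in> ?V"
    by (simp only: mfps.span_neg)
  then show ?thesis unfolding t sign by simp
qed

text \<open>The reference filtration: all comparisons of generators modulo smaller sizes are made in
  it.\<close>

abbreviation W :: "nat \<Rightarrow> qbeta mfps set" where "W \<equiv> level p_beta \<O>\<P>"

lemmas W_mult_Suc = level_mult_Suc[OF add_closed_OP]

lemma p_beta_in_level:
  assumes "odd k"
  shows "p_beta k \<in> W (Suc k)"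
proof -
  have "{#k#} \<in> \<O>\<P>"
    using assms by (cases k) (auto simp: odd_partitions_def partitions_def)
  from level_base[OF this, of "Suc k" p_beta] show ?thesis by (simp add: prod_parts_def)
qed

lemma newton_coeff_in_W: "newton_coeff k \<in> W (Suc k)"
  by (auto simp: newton_coeff_def intro: level_scale p_beta_in_level level_zero)

lemma schur_q_in_W: "schur_q n \<in> W (Suc n)"
proof (induction n rule: less_induct)
  case (less n)
  show ?case
  proof (cases n)
    case (Suc m)
    have "(\<Sum>k<n. newton_coeff (n - k) * schur_q k) \<in> W (Suc n)"
      by (intro level_sum W_mult_Suc[OF newton_coeff_in_W less.IH]) auto
    then show ?thesis
      unfolding schur_q_newton[symmetric] unfolding Suc by (rule level_of_nat_mult)
  qed (simp add: level_one[OF add_closed_OP])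
qed

text \<open>The scalars admit both families at once: they are 1 for \<open>q_beta\<close> and
  \<open>(-1)^n\<close> for \<open>qbar_beta\<close>. Index 0 is left out because partitions have no
  part 0.\<close>

definition schur_like :: "(nat \<Rightarrow> qbeta) \<Rightarrow> (nat \<Rightarrow> qbeta mfps) \<Rightarrow> bool" where
  "schur_like \<epsilon> s \<longleftrightarrow> (\<forall>n>0. \<epsilon> n \<noteq> 0 \<and> s n - mscale (\<epsilon> n) (schur_q n) \<in> W n)"

lemma schur_likeD:
  assumes "schur_like \<epsilon> s" "n > 0"
  shows "\<epsilon> n \<noteq> 0" "s n - mscale (\<epsilon> n) (schur_q n) \<in> W n"
  using assms by (auto simp: schur_like_def)

lemma schur_like_in_W:
  assumes "schur_like \<epsilon> s" "n > 0"
  shows "s n \<in> W (Suc n)"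
proof -
  have "s n - mscale (\<epsilon> n) (schur_q n) \<in> W (Suc n)"
    using schur_likeD(2)[OF assms] by (rule level_monoD) simp
  from level_add[OF this level_scale[OF schur_q_in_W[of n], of "\<epsilon> n"]] show ?thesis by simp
qed

lemma schur_like_prod_in_W:
  assumes "schur_like \<epsilon> s" "\<mu> \<in> partitions"
  shows "prod_parts s \<mu> \<in> W (Suc (\<Sum>\<^sub># \<mu>))"
  by (rule prod_parts_in_level[OF add_closed_OP])
    (use assms in \<open>auto simp: partitions_def intro!: schur_like_in_W intro: gr0I\<close>)

lemma schur_like_level_subset:
  assumes "schur_like \<epsilon> s" "J \<subseteq> partitions"
  shows "level s J n \<subseteq> W n"
proof (rule level_least[OF level_subspace])
  fix \<mu> assume "\<mu> \<in> J" "\<Sum>\<^sub># \<mu> < n"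
  then show "prod_parts s \<mu> \<in> W n"
    using assms by (intro level_monoD[OF schur_like_prod_in_W[OF assms(1)]]) auto
qed

text \<open>Upward in \<open>n\<close>: for odd \<open>n\<close>, \<open>s n\<close> is itself a
  generator and its error lies in \<open>W n\<close>, which is already covered; this yields
  \<open>schur_q n\<close> and then, by the Newton identity, \<open>p_beta n\<close>.\<close>

lemma schur_like_level_odd:
  assumes s: "schur_like \<epsilon> s"
  shows "W n \<subseteq> level s \<O>\<P> n"
proof -
  let ?X = "level s \<O>\<P>"
  \<comment> \<open>Partitions of size below \<open>n\<close> have only parts below
    \<open>n\<close>, so the induction hypothesis covers \<open>W n\<close>.\<close>
  have step: "W n \<subseteq> ?X n" if "\<And>k. k < n \<Longrightarrow> odd k \<Longrightarrow> p_beta k \<in> ?X (Suc k)" for n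
  proof (rule level_least[OF level_subspace])
    fix \<mu> assume \<mu>: "\<mu> \<in> \<O>\<P>" "\<Sum>\<^sub># \<mu> < n"
    have "p_beta k \<in> ?X (Suc k)" if k: "k \<in># \<mu>" for k
    proof (rule \<open>\<And>k. k < n \<Longrightarrow> odd k \<Longrightarrow> p_beta k \<in> ?X (Suc k)\<close>)
      show "odd k" using \<mu>(1) k by (simp add: odd_partitions_def)
      have "k \<le> \<Sum>\<^sub># \<mu>" using multi_member_split[OF k] by auto
      then show "k < n" using \<mu>(2) by simp
    qed
    from level_monoD[OF prod_parts_in_level[OF add_closed_OP this]] \<mu>(2)
    show "prod_parts p_beta \<mu> \<in> ?X n" by auto
  qed
  have "schur_q n \<in> ?X (Suc n) \<and> (odd n \<longrightarrow> p_beta n \<in> ?X (Suc n))" for n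
  proof (induction n rule: less_induct)
    case (less n)
    have E: "schur_q k \<in> ?X (Suc k)" and P: "odd k \<Longrightarrow> p_beta k \<in> ?X (Suc k)" if "k < n" for k
      using less.IH[OF that] by auto
    have WX: "W n \<subseteq> ?X n" by (rule step) (use P in auto)
    have G: "newton_coeff k \<in> ?X (Suc k)" if "k < n" for k
      using P[OF that] by (auto simp: newton_coeff_def intro: level_scale level_zero)
    have rest: "(\<Sum>k\<in>{1..<n}. newton_coeff (n - k) * schur_q k) \<in> ?X (Suc n)"
      by (intro level_sum level_mult_Suc[OF add_closed_OP G E]) auto
    show ?case
    proof (cases "n = 0")
      case True
      then show ?thesis by (simp add: level_one[OF add_closed_OP])
    next
      case n0: False
      \<comment> \<open>The term \<open>k = 0\<close> is split off: for odd \<open>n\<close> it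
        carries \<open>p_beta n\<close>; for even \<open>n\<close> it vanishes, and smaller indices
        give \<open>schur_q n\<close>.\<close>
      have newton: "of_nat n * schur_q n = newton_coeff n + (\<Sum>k\<in>{1..<n}. newton_coeff (n - k) * schur_q k)"
        unfolding schur_q_newton lessThan_atLeast0 using n0 by (subst sum.atLeast_Suc_lessThan) auto
      obtain m where m: "n = Suc m" using n0 by (cases n) auto
      show ?thesis
      proof (cases "odd n")
        case False
        then have "of_nat n * schur_q n \<in> ?X (Suc n)"
          unfolding newton using rest by (simp add: newton_coeff_def)
        then have "schur_q n \<in> ?X (Suc n)" unfolding m by (rule level_of_nat_mult)
        with False show ?thesis by simp
      next
        case True
        have "{#n#} \<in> \<O>\<P>" using True n0 by (auto simp: odd_partitions_def partitions_def)
        from level_base[OF this, of "Suc n" s] have "s n \<in> ?X (Suc n)" by (simp add: prod_parts_def)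
        moreover have "s n - mscale (\<epsilon> n) (schur_q n) \<in> ?X (Suc n)"
          using schur_likeD(2)[OF s, of n] n0 WX by (intro level_monoD[of _ _ _ n "Suc n"]) auto
        ultimately have "s n - (s n - mscale (\<epsilon> n) (schur_q n)) \<in> ?X (Suc n)"
          by (rule level_diff)
        then have "mscale (\<epsilon> n) (schur_q n) \<in> ?X (Suc n)" by simp
        from level_scale[OF this, of "1 / \<epsilon> n"] have E_n: "schur_q n \<in> ?X (Suc n)"
          using schur_likeD(1)[OF s, of n] n0 by simp
        have "of_nat n * schur_q n - (\<Sum>k\<in>{1..<n}. newton_coeff (n - k) * schur_q k) \<in> ?X (Suc n)"
          unfolding mscale_of_nat[symmetric] by (intro level_diff level_scale E_n rest)
        then have "mscale 2 (p_beta n) \<in> ?X (Suc n)"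
          unfolding newton using True by (simp add: newton_coeff_def)
        from level_scale[OF this, of "1 / 2"] E_n show ?thesis by simp
      qed
    qed
  qed
  then show ?thesis by (intro step) auto
qed

text \<open>The factors are exchanged one at a time, so each difference has one factor of smaller
  size.\<close>

lemma schur_like_mult:
  assumes s: "schur_like \<epsilon> s" and ij: "i > 0" "j > 0"
  shows "s i * s j - mscale (\<epsilon> i * \<epsilon> j) (schur_q i * schur_q j) \<in> W (i + j)"
proof -
  have "s i * (s j - mscale (\<epsilon> j) (schur_q j)) \<in> W (i + j)"
    by (rule level_mult[OF add_closed_OP schur_like_in_W[OF s ij(1)] schur_likeD(2)[OF s ij(2)]])
  moreover have "mscale (\<epsilon> j) (schur_q j) * (s i - mscale (\<epsilon> i) (schur_q i)) \<in> W (j + i)"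
    by (rule level_mult[OF add_closed_OP level_scale[OF schur_q_in_W] schur_likeD(2)[OF s ij(1)]])
  ultimately have "s i * (s j - mscale (\<epsilon> j) (schur_q j)) +
      mscale (\<epsilon> j) (schur_q j) * (s i - mscale (\<epsilon> i) (schur_q i)) \<in> W (i + j)"
    by (intro level_add) (simp_all add: add.commute)
  also have "s i * (s j - mscale (\<epsilon> j) (schur_q j)) +
      mscale (\<epsilon> j) (schur_q j) * (s i - mscale (\<epsilon> i) (schur_q i)) =
      s i * s j - mscale (\<epsilon> i * \<epsilon> j) (schur_q i * schur_q j)"
    by (simp add: right_diff_distrib mscale_mult_left mscale_mult_right mult_ac)
  finally show ?thesis .
qed

text \<open>Bounds the sum of squares at fixed size, so that its growth can serve as a termination
  measure.\<close>

lemma sum_squares_le_square_sum: "(\<Sum>i\<in>#\<mu>. i\<^sup>2) \<le> (\<Sum>\<^sub># \<mu> :: nat)\<^sup>2"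
  by (induction \<mu>) (auto simp: power2_sum)

text \<open>
  A repeated part \<open>a\<close> is removed by writing \<open>schur_q a\<^sup>2\<close> in terms of the products
  \<open>schur_q i * schur_q (2 a - i)\<close> with \<open>i < a\<close>. At fixed size this increases the sum of the squares of
  the parts, and the error terms belong to smaller partitions.
\<close>

lemma schur_like_prod_in_strict_level:
  assumes s: "schur_like \<epsilon> s" and "\<mu> \<in> partitions"
  shows "prod_parts s \<mu> \<in> level s \<S>\<P> (Suc (\<Sum>\<^sub># \<mu>))"
proof -
  let ?Y = "level s \<S>\<P>"
  let ?sq = "\<lambda>\<mu>. \<Sum>i\<in>#\<mu>. i\<^sup>2 :: nat"
  \<comment> \<open>Smaller size first; at equal size, larger sum of squares.\<close>
  let ?R = "measures [\<lambda>\<mu>. \<Sum>\<^sub># \<mu>, \<lambda>\<mu>. (\<Sum>\<^sub># \<mu>)\<^sup>2 - ?sq \<mu>]"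
  have "wf ?R" by (rule wf_measures)
  from this assms(2) show ?thesis
  proof (induction \<mu> rule: wf_induct_rule)
    case (less \<mu>)
    show ?case
    proof (cases "\<mu> \<in> \<S>\<P>")
      case True
      then show ?thesis by (rule level_base) simp
    next
      case False
      then obtain a where a: "a \<in># \<mu>" "count \<mu> a \<noteq> 1"
        using less.prems by (auto simp: strict_partitions_def)
      then have "count \<mu> a > 0" by simp
      with a(2) have "count \<mu> a \<ge> 2" by linarith
      then have "replicate_mset 2 a \<subseteq># \<mu>" by (simp add: count_le_replicate_mset_subset_eq)
      then obtain \<rho> where "\<mu> = replicate_mset 2 a + \<rho>"
        by (auto simp: mset_subset_eq_exists_conv)
      then have \<rho>: "\<mu> = add_mset a (add_mset a \<rho>)"
        by (simp add: numeral_2_eq_2)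
      have a0: "a > 0" and \<rho>p: "\<rho> \<in> partitions"
        using less.prems by (auto simp: \<rho> add_mset_partitions)
      define N where "N = \<Sum>\<^sub># \<mu>"
      have N: "N = 2 * a + \<Sum>\<^sub># \<rho>" by (simp add: N_def \<rho>)
      have smaller: "prod_parts s \<nu> \<in> ?Y (Suc (\<Sum>\<^sub># \<nu>))" if "\<nu> \<in> partitions" "\<Sum>\<^sub># \<nu> < N" for \<nu>
        using that by (intro less.IH) (auto simp: N_def)
      have equal: "prod_parts s \<nu> \<in> ?Y (Suc N)"
        if "\<nu> \<in> partitions" "\<Sum>\<^sub># \<nu> = N" "?sq \<mu> < ?sq \<nu>" for \<nu>
      proof -
        have "?sq \<nu> \<le> N\<^sup>2" using sum_squares_le_square_sum[of \<nu>] that(2) by simp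
        then have "(\<nu>, \<mu>) \<in> ?R" using that by (simp add: N_def)
        from less.IH[OF this that(1)] show ?thesis by (simp add: that(2))
      qed
      \<comment> \<open>Error terms are rewritten in odd products of \<open>s\<close> of size below
        \<open>N\<close>, to which the induction hypothesis applies.\<close>
      have WY: "W N \<subseteq> ?Y N"
      proof (rule order_trans[OF schur_like_level_odd[OF s]], rule level_least[OF level_subspace])
        fix \<nu> assume "\<nu> \<in> \<O>\<P>" "\<Sum>\<^sub># \<nu> < N"
        then show "prod_parts s \<nu> \<in> ?Y N"
          by (intro level_monoD[OF smaller]) (auto simp: odd_partitions_def)
      qed
      let ?r = "prod_parts s \<rho>"
      have low: "x * ?r \<in> ?Y (Suc N)" if "x \<in> W (2 * a)" for x
      proof -
        have "?r * x \<in> W (\<Sum>\<^sub># \<rho> + 2 * a)"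
          by (rule level_mult[OF add_closed_OP schur_like_prod_in_W[OF s \<rho>p] that])
        then have "x * ?r \<in> ?Y N"
          using WY by (auto simp: N mult.commute add.commute)
        then show ?thesis by (rule level_monoD) simp
      qed
      \<comment> \<open>Passes from products of \<open>s\<close> to products of
        \<open>schur_q\<close>, where the quadratic relation holds exactly.\<close>
      have unscale: "y * ?r \<in> ?Y (Suc N)"
        if "c \<noteq> 0" "x - mscale c y \<in> W (2 * a)" "x * ?r \<in> ?Y (Suc N)" for c x y
      proof -
        have "x * ?r - (x - mscale c y) * ?r \<in> ?Y (Suc N)"
          by (rule level_diff[OF that(3) low[OF that(2)]])
        then have "mscale c (y * ?r) \<in> ?Y (Suc N)"
          by (simp add: left_diff_distrib mscale_mult_left)
        from level_scale[OF this, of "1 / c"] that(1) show ?thesis by simp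
      qed
      have gen: "schur_q i * schur_q (2 * a - i) * ?r \<in> ?Y (Suc N)" if i: "i < a" for i
      proof (cases "i = 0")
        case True
        \<comment> \<open>Here \<open>a, a\<close> merge into the single part \<open>2 * a\<close>;
          a part 0 is not allowed.\<close>
        have "prod_parts s (add_mset (2 * a) \<rho>) \<in> ?Y (Suc N)"
          by (rule equal) (use a0 \<rho>p in \<open>auto simp: add_mset_partitions N \<rho> power2_eq_square\<close>)
        then have "s (2 * a) * ?r \<in> ?Y (Suc N)" by simp
        moreover have "2 * a > 0" using a0 by simp
        ultimately have "schur_q (2 * a) * ?r \<in> ?Y (Suc N)"
          using unscale[OF schur_likeD[OF s]] by blast
        with True show ?thesis by simp
      next
        case False
        \<comment> \<open>With this \<open>b\<close>, the squares of \<open>i\<close> and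
          \<open>2 * a - i\<close> exceed \<open>2 * a^2\<close> by \<open>2 * b^2\<close>.\<close>
        define b where "b = a - i"
        have b: "a = i + b" "b > 0" using i by (simp_all add: b_def)
        have "prod_parts s (add_mset i (add_mset (2 * a - i) \<rho>)) \<in> ?Y (Suc N)"
        proof (rule equal)
          show "add_mset i (add_mset (2 * a - i) \<rho>) \<in> partitions"
            using False i \<rho>p by (simp add: add_mset_partitions)
          show "\<Sum>\<^sub># (add_mset i (add_mset (2 * a - i) \<rho>)) = N"
            using i by (simp add: N)
          have "2 * a - i = i + 2 * b" using b by simp
          then have "a\<^sup>2 + a\<^sup>2 < i\<^sup>2 + (2 * a - i)\<^sup>2"
            using b by (simp add: power2_eq_square algebra_simps)
          then show "?sq \<mu> < ?sq (add_mset i (add_mset (2 * a - i) \<rho>))"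
            by (simp add: \<rho>)
        qed
        then have prod: "s i * s (2 * a - i) * ?r \<in> ?Y (Suc N)" by (simp add: mult.assoc)
        have diff: "s i * s (2 * a - i) - mscale (\<epsilon> i * \<epsilon> (2 * a - i)) (schur_q i * schur_q (2 * a - i)) \<in> W (2 * a)"
          using schur_like_mult[OF s, of i "2 * a - i"] False i by simp
        have "\<epsilon> i * \<epsilon> (2 * a - i) \<noteq> 0"
          using schur_likeD(1)[OF s] False i by simp
        from unscale[OF this diff prod] show ?thesis .
      qed
      have "mfps.span ((\<lambda>i. schur_q i * schur_q (2 * a - i)) ` {..<a}) \<subseteq> {x. x * ?r \<in> ?Y (Suc N)}"
        by (rule mfps.span_minimal[OF _ subspace_vimage_mult[OF level_subspace]]) (use gen in auto)
      then have sq: "schur_q a * schur_q a * ?r \<in> ?Y (Suc N)"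
        using schur_q_square[OF a0] by auto
      have "s a * s a - mscale (\<epsilon> a * \<epsilon> a) (schur_q a * schur_q a) \<in> W (2 * a)"
        using schur_like_mult[OF s a0 a0] by (simp add: mult_2)
      from level_add[OF low[OF this] level_scale[OF sq, of "\<epsilon> a * \<epsilon> a"]]
      have "s a * s a * ?r \<in> ?Y (Suc N)"
        by (simp add: left_diff_distrib mscale_mult_left)
      then show ?thesis by (simp add: \<rho> N_def mult.assoc)
    qed
  qed
qed

lemma schur_like_bases:
  assumes s: "schur_like \<epsilon> s"
  shows "is_basis_family (prod_parts s) \<O>\<P> g\<Gamma>" "is_basis_family (prod_parts s) \<S>\<P> g\<Gamma>"
proof -
  have sub: "\<O>\<P> \<subseteq> partitions" "\<S>\<P> \<subseteq> partitions"
    by (auto simp: odd_partitions_def strict_partitions_def)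
  have OP: "level s \<O>\<P> n = W n" for n
    using schur_like_level_subset[OF s sub(1)] schur_like_level_odd[OF s] by blast
  show "is_basis_family (prod_parts s) \<O>\<P> g\<Gamma>"
    by (rule basis_of_levels[OF sub(1) order_refl OP])
  have SP: "level s \<S>\<P> n = W n" for n
  proof
    show "W n \<subseteq> level s \<S>\<P> n"
      unfolding OP[symmetric]
    proof (rule level_least[OF level_subspace])
      fix \<mu> assume "\<mu> \<in> \<O>\<P>" "\<Sum>\<^sub># \<mu> < n"
      then show "prod_parts s \<mu> \<in> level s \<S>\<P> n"
        using sub by (intro level_monoD[OF schur_like_prod_in_strict_level[OF s]]) auto
    qed
  qed (rule schur_like_level_subset[OF s sub(2)])
  show "is_basis_family (prod_parts s) \<S>\<P> g\<Gamma>"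
    by (rule basis_of_levels[OF sub(2) card_strict_le_card_odd SP])
qed

section \<open>Newton identities for the generating series\<close>

text \<open>\<open>mlim\<close> is a definite description and says nothing without convergence; the
  relation carries convergence through sums and products.\<close>

definition coeff_limit :: "(nat \<Rightarrow> 'a mfps) \<Rightarrow> 'a mfps \<Rightarrow> bool" where
  "coeff_limit F f \<longleftrightarrow> (\<forall>m. \<forall>\<^sub>F N in sequentially. mcoeff (F N) m = mcoeff f m)"

lemma coeff_limit_mlim:
  assumes "\<And>m. \<exists>c. \<forall>\<^sub>F N in sequentially. mcoeff (F N) m = c"
  shows "coeff_limit F (mlim F)"
  unfolding coeff_limit_def
proof
  fix m
  obtain c where c: "\<forall>\<^sub>F N in sequentially. mcoeff (F N) m = c" using assms by blast
  then obtain N0 where "\<And>N. N \<ge> N0 \<Longrightarrow> mcoeff (F N) m = c"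
    by (auto simp: eventually_sequentially)
  then have "mcoeff (mlim F) m = c" by (rule mcoeff_mlim)
  with c show "\<forall>\<^sub>F N in sequentially. mcoeff (F N) m = mcoeff (mlim F) m" by simp
qed

lemma coeff_limit_unique:
  assumes "coeff_limit F f" "coeff_limit F g"
  shows "f = g"
proof (rule mfps_eqI)
  fix m
  have "\<forall>\<^sub>F N in sequentially. mcoeff (F N) m = mcoeff f m \<and> mcoeff (F N) m = mcoeff g m"
    using assms by (intro eventually_conj) (simp_all add: coeff_limit_def)
  then show "mcoeff f m = mcoeff g m"
    using eventually_happens'[OF sequentially_bot] by fastforce
qed

lemma coeff_limit_const: "coeff_limit (\<lambda>_. f) f"
  by (simp add: coeff_limit_def)

lemma coeff_limit_mscale:
  assumes "coeff_limit F f"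
  shows "coeff_limit (\<lambda>N. mscale c (F N)) (mscale c f)"
  unfolding coeff_limit_def mcoeff_mscale
proof
  fix m
  have "\<forall>\<^sub>F N in sequentially. mcoeff (F N) m = mcoeff f m"
    using assms by (simp add: coeff_limit_def)
  then show "\<forall>\<^sub>F N in sequentially. c * mcoeff (F N) m = c * mcoeff f m"
    by (rule eventually_mono) simp
qed

lemma coeff_limit_add:
  assumes "coeff_limit F f" "coeff_limit G g"
  shows "coeff_limit (\<lambda>N. F N + G N) (f + g)"
  unfolding coeff_limit_def mcoeff_add
proof
  fix m
  have "\<forall>\<^sub>F N in sequentially. mcoeff (F N) m = mcoeff f m"
    "\<forall>\<^sub>F N in sequentially. mcoeff (G N) m = mcoeff g m"
    using assms by (simp_all add: coeff_limit_def)
  then show "\<forall>\<^sub>F N in sequentially. mcoeff (F N) m + mcoeff (G N) m = mcoeff f m + mcoeff g m"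
    by (rule eventually_elim2) simp
qed

lemma coeff_limit_sum:
  "(\<And>i. i \<in> A \<Longrightarrow> coeff_limit (F i) (f i)) \<Longrightarrow> coeff_limit (\<lambda>N. \<Sum>i\<in>A. F i N) (\<Sum>i\<in>A. f i)"
  by (induction A rule: infinite_finite_induct) (simp_all add: coeff_limit_add coeff_limit_const)

text \<open>A coefficient of a product involves finitely many coefficients of the factors, and these
  are eventually constant simultaneously.\<close>

lemma coeff_limit_mult:
  assumes "coeff_limit F f" "coeff_limit G g"
  shows "coeff_limit (\<lambda>N. F N * G N) (f * g)"
  unfolding coeff_limit_def
proof
  fix m
  have "\<forall>\<^sub>F N in sequentially. \<forall>p\<in>splits m.
      mcoeff (F N) (fst p) = mcoeff f (fst p) \<and> mcoeff (G N) (snd p) = mcoeff g (snd p)"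
    using assms by (intro eventually_ball_finite finite_splits ballI eventually_conj) (simp_all add: coeff_limit_def)
  then show "\<forall>\<^sub>F N in sequentially. mcoeff (F N * G N) m = mcoeff (f * g) m"
    by (rule eventually_mono) (auto simp: mcoeff_mult intro!: sum.cong)
qed

section \<open>Logarithmic derivative of the factors of Q(z)\<close>

definition geometric :: "'a::comm_ring_1 \<Rightarrow> 'a fps" where
  "geometric y = Abs_fps (\<lambda>n. y ^ n)"

lemma geometric_inverse: "(1 - fps_const y * fps_X) * geometric y = 1"
proof (rule fps_ext)
  fix n
  show "((1 - fps_const y * fps_X) * geometric y) $ n = 1 $ n"
    by (cases n) (simp_all add: left_diff_distrib mult.assoc geometric_def)
qed

lemma fps_right_inverse_linear: "fps_right_inverse (1 - fps_const y * fps_X) 1 = geometric y"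
proof -
  let ?r = "fps_right_inverse (1 - fps_const y * fps_X) 1"
  have "(1 - fps_const y * fps_X) * ?r = 1" by (rule fps_right_inverse) simp
  then have "geometric y = geometric y * ((1 - fps_const y * fps_X) * ?r)" by simp
  also have "\<dots> = ((1 - fps_const y * fps_X) * geometric y) * ?r" by (simp only: mult_ac)
  also have "\<dots> = ?r" by (simp only: geometric_inverse mult_1)
  finally show ?thesis ..
qed

lemma fps_deriv_geometric: "fps_deriv (geometric y) = fps_const y * geometric y * geometric y"
proof -
  let ?l = "1 - fps_const y * fps_X"
  have "fps_deriv (?l * geometric y) = 0" by (simp add: geometric_inverse)
  then have "?l * fps_deriv (geometric y) = fps_const y * geometric y"
    by (simp del: fps_const_neg)
  then have "(?l * geometric y) * fps_deriv (geometric y) = geometric y * (fps_const y * geometric y)"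
    by (simp only: mult_ac)
  then have "fps_deriv (geometric y) = geometric y * (fps_const y * geometric y)"
    by (simp only: geometric_inverse mult_1)
  then show ?thesis by (simp only: mult_ac)
qed

abbreviation beta_const :: "qbeta mfps" where "beta_const \<equiv> mscale \<beta> 1"

lemma zbar_geometric: "zbar = - fps_X * geometric (- beta_const)"
proof -
  have "1 + fps_const beta_const * fps_X = 1 - fps_const (- beta_const) * fps_X"
    by (simp flip: fps_const_neg)
  then show ?thesis by (simp only: zbar_def fps_right_inverse_linear)
qed

text \<open>With \<open>x = var i\<close>, the expansion of \<open>x/(1 - x z) - \<beta>/(1 +
  \<beta> z) + (x + \<beta>)/(1 + (x + \<beta>) z)\<close>.\<close>

definition log_deriv :: "nat \<Rightarrow> qbeta mfps fps" where
  "log_deriv i = Abs_fps (\<lambda>n. var i ^ Suc n + (- beta_const) ^ Suc n - (- (var i + beta_const)) ^ Suc n)"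

lemma log_deriv_geometric:
  "log_deriv i = fps_const (var i) * geometric (var i) + fps_const (- beta_const) * geometric (- beta_const)
    - fps_const (- (var i + beta_const)) * geometric (- (var i + beta_const))"
  by (rule fps_ext) (simp add: log_deriv_def geometric_def)

text \<open>From \<open>1 - x zbar = (1 + (x + \<beta>) z)/(1 + \<beta> z)\<close>: every factor is
  a quotient of linear ones.\<close>

lemma Q_factor_eq:
  "Q_factor i = (1 - fps_const (- (var i + beta_const)) * fps_X) * (geometric (- beta_const) * geometric (var i))"
proof -
  let ?c = "geometric (- beta_const)"
  have "1 - fps_const (var i) * zbar = (1 - fps_const (- beta_const) * fps_X) * ?c + fps_const (var i) * fps_X * ?c"
    by (simp only: geometric_inverse zbar_geometric) simp
  also have "\<dots> = (1 - fps_const (- (var i + beta_const)) * fps_X) * ?c"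
  proof -
    have "fps_const (- (var i + beta_const)) = - fps_const (var i) - fps_const beta_const"
      by simp
    moreover have "fps_const (- beta_const) = - fps_const beta_const" by simp
    moreover have "(1 - - b * X) * c + x * X * c = (1 - (- x - b) * X) * c" for b x X c :: "qbeta mfps fps"
      by (simp add: algebra_simps)
    ultimately show ?thesis by (simp only:)
  qed
  finally show ?thesis
    by (simp only: Q_factor_def fps_right_inverse_linear mult.assoc)
qed

lemma fps_deriv_Q_factor: "fps_deriv (Q_factor i) = Q_factor i * log_deriv i"
proof -
  define x b y where "x = fps_const (var i :: qbeta mfps)" and "b = fps_const (- beta_const)"
    and "y = fps_const (- (var i + beta_const))"
  define gx gb gy where "gx = geometric (var i :: qbeta mfps)" and "gb = geometric (- beta_const)"
    and "gy = geometric (- (var i + beta_const))"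
  have dx: "fps_deriv gx = x * gx * gx" and db: "fps_deriv gb = b * gb * gb"
    by (simp_all only: gx_def gb_def x_def b_def fps_deriv_geometric)
  have inv: "(1 - y * fps_X) * gy = 1"
    by (simp only: y_def gy_def geometric_inverse)
  have dy: "fps_deriv y = 0" by (simp add: y_def)
  have "fps_deriv ((1 - y * fps_X) * (gb * gx)) =
      (1 - y * fps_X) * (gb * gx) * (x * gx + b * gb) - y * (gb * gx)"
    by (simp add: dx db dy algebra_simps)
  \<comment> \<open>Inserting \<open>(1 - y X) gy = 1\<close> lets the whole factor be pulled
    out.\<close>
  also have "y * (gb * gx) = ((1 - y * fps_X) * gy) * (y * (gb * gx))"
    by (simp only: inv mult_1)
  also have "(1 - y * fps_X) * (gb * gx) * (x * gx + b * gb) - \<dots> =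
      (1 - y * fps_X) * (gb * gx) * (x * gx + b * gb - y * gy)"
    by (simp add: algebra_simps)
  finally show ?thesis
    by (simp only: Q_factor_eq log_deriv_geometric x_def b_def y_def gx_def gb_def gy_def)
qed

lemma fps_deriv_prod_Q_factor:
  "fps_deriv (\<Prod>i<N. Q_factor i) = (\<Prod>i<N. Q_factor i) * (\<Sum>i<N. log_deriv i)"
  by (induction N) (simp_all add: fps_deriv_Q_factor algebra_simps)

lemma coeff_limit_q_beta: "coeff_limit (\<lambda>N. (\<Prod>i<N. Q_factor i) $ n) (q_beta n)"
  using coeff_limit_mlim[OF Q_beta_limit_exists] by (simp add: q_beta_def Q_beta_def)

lemma q_beta_0: "q_beta 0 = 1"
proof -
  have "(\<Prod>i<N. Q_factor i) $ 0 = 1" for N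
    by (induction N) (simp_all add: Q_factor_eq geometric_def)
  then show ?thesis
    using coeff_limit_unique[OF coeff_limit_q_beta[of 0]] coeff_limit_const[of 1] by simp
qed

text \<open>The defining sum is a binomial expansion without its constant term; subtracting that
  term makes each summand divisible by its variable.\<close>

lemma coeff_limit_p_beta:
  "coeff_limit (\<lambda>N. \<Sum>i<N. (var i + mscale (\<beta> / 2) 1) ^ n - mscale (\<beta> / 2) 1 ^ n) (p_beta n)"
proof -
  let ?B = "mscale (\<beta> / 2) 1 :: qbeta mfps"
  have "coeff_limit (\<lambda>N. \<Sum>k<n. mscale (of_nat (n choose k) * (\<beta> / 2) ^ k) (\<Sum>j<N. var j ^ (n - k))) (p_beta n)"
    unfolding p_beta_def power_sum_def
    by (intro coeff_limit_sum coeff_limit_mscale coeff_limit_mlim power_sum_limit_exists) simp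
  moreover have "(\<Sum>k<n. mscale (of_nat (n choose k) * (\<beta> / 2) ^ k) (\<Sum>j<N. var j ^ (n - k))) =
      (\<Sum>i<N. (var i + ?B) ^ n - ?B ^ n)" for N
  proof -
    have tm: "mscale (of_nat (n choose k) * (\<beta> / 2) ^ k) x = of_nat (n choose k) * ?B ^ k * x" for k x
      by (simp add: mscale_one_power mscale_mult_left mscale_of_nat[symmetric])
    have "(\<Sum>k<n. mscale (of_nat (n choose k) * (\<beta> / 2) ^ k) (\<Sum>j<N. var j ^ (n - k))) =
        (\<Sum>j<N. \<Sum>k<n. of_nat (n choose k) * ?B ^ k * var j ^ (n - k))"
      unfolding tm sum_distrib_left by (rule sum.swap)
    also have "\<dots> = (\<Sum>i<N. (var i + ?B) ^ n - ?B ^ n)"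
    proof (rule sum.cong[OF refl])
      fix j
      have "(?B + var j) ^ n = (\<Sum>k\<le>n. of_nat (n choose k) * ?B ^ k * var j ^ (n - k))"
        by (rule binomial_ring)
      also have "\<dots> = (\<Sum>k<n. of_nat (n choose k) * ?B ^ k * var j ^ (n - k)) + ?B ^ n"
        by (simp add: lessThan_Suc_atMost[symmetric])
      finally show "(\<Sum>k<n. of_nat (n choose k) * ?B ^ k * var j ^ (n - k)) = (var j + ?B) ^ n - ?B ^ n"
        by (simp add: add.commute)
    qed
    finally show ?thesis .
  qed
  ultimately show ?thesis by simp
qed

text \<open>For \<open>k > 0\<close>, the coefficient of \<open>z^(k-1)\<close> in the logarithmic
  derivative of Q(z), expanded around -\<beta>/2. Its top term \<open>j = k\<close> is the classical
  one.\<close>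

definition q_newton_coeff :: "nat \<Rightarrow> qbeta mfps" where
  "q_newton_coeff k = (\<Sum>j\<le>k. mscale (of_nat (k choose j) * (- (\<beta> / 2)) ^ (k - j)) (newton_coeff j))"

text \<open>In terms of \<open>u = x + B\<close> with \<open>B = \<beta>/2\<close>, the left-hand side is an odd function of \<open>u\<close>.\<close>

lemma odd_part_expansion:
  fixes x B :: "'a::comm_ring_1"
  assumes "k > 0"
  shows "x ^ k + (- (2 * B)) ^ k - (- (x + 2 * B)) ^ k =
    (\<Sum>j\<le>k. of_nat (k choose j) * (- B) ^ (k - j) * (if odd j then 2 * ((x + B) ^ j - B ^ j) else 0))"
proof -
  have *: "(u + - B) ^ k - (- u + - B) ^ k = (\<Sum>j\<le>k. of_nat (k choose j) * (- B) ^ (k - j) * (u ^ j - (- u) ^ j))" for u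
    unfolding binomial_ring sum_subtractf[symmetric] by (rule sum.cong) (simp_all add: algebra_simps)
  \<comment> \<open>The identity is used at \<open>u = x + B\<close> and at \<open>u = B\<close>;
    the second use supplies \<open>(- (2 * B))^k\<close>, because \<open>0^k = 0\<close> for
    \<open>k > 0\<close>.\<close>
  have "x ^ k + (- (2 * B)) ^ k - (- (x + 2 * B)) ^ k =
      ((x + B + - B) ^ k - (- (x + B) + - B) ^ k) - ((B + - B) ^ k - (- B + - B) ^ k)"
  proof -
    have "x + B + - B = x" "- (x + B) + - B = - (x + 2 * B)" "B + - B = 0" "- B + - B = - (2 * B)"
      by (simp_all add: algebra_simps)
    moreover have "0 ^ k = (0 :: 'a)" using assms by (cases k) simp_all
    ultimately show ?thesis by (simp only:) simp
  qed
  also have "\<dots> = (\<Sum>j\<le>k. of_nat (k choose j) * (- B) ^ (k - j) *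
      (((x + B) ^ j - (- (x + B)) ^ j) - (B ^ j - (- B) ^ j)))"
    unfolding * sum_subtractf[symmetric] by (rule sum.cong) (simp_all only: right_diff_distrib)
  also have "\<dots> = (\<Sum>j\<le>k. of_nat (k choose j) * (- B) ^ (k - j) * (if odd j then 2 * ((x + B) ^ j - B ^ j) else 0))"
    by (rule sum.cong) (simp_all add: power_minus_odd del: minus_add_distrib)
  finally show ?thesis .
qed

lemma coeff_limit_log_deriv: "coeff_limit (\<lambda>N. \<Sum>i<N. log_deriv i $ n) (q_newton_coeff (Suc n))"
proof -
  let ?B = "mscale (\<beta> / 2) 1 :: qbeta mfps"
  let ?s = "\<lambda>j N. \<Sum>i<N. (var i + ?B) ^ j - ?B ^ j"
  let ?c = "\<lambda>j. of_nat (Suc n choose j) * (- (\<beta> / 2)) ^ (Suc n - j)"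
  have two_B: "beta_const = 2 * ?B"
    using mscale_of_nat[of 2 ?B] by (simp add: numeral_eq_Suc)
  have neg_B: "- ?B = mscale (- (\<beta> / 2)) 1"
    by (rule mfps_eqI) (simp add: mcoeff_mscale mcoeff_uminus)
  have two: "2 * x = mscale 2 x" for x :: "qbeta mfps"
    using mscale_of_nat[of 2 x] by simp
  have "coeff_limit (\<lambda>N. \<Sum>j\<le>Suc n. mscale (?c j) (if odd j then mscale 2 (?s j N) else 0)) (q_newton_coeff (Suc n))"
    unfolding q_newton_coeff_def
  proof (intro coeff_limit_sum coeff_limit_mscale)
    fix j
    show "coeff_limit (\<lambda>N. if odd j then mscale 2 (?s j N) else 0) (newton_coeff j)"
      by (cases "odd j") (simp_all add: newton_coeff_def coeff_limit_const coeff_limit_mscale[OF coeff_limit_p_beta])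
  qed
  moreover have "(\<Sum>j\<le>Suc n. mscale (?c j) (if odd j then mscale 2 (?s j N) else 0)) = (\<Sum>i<N. log_deriv i $ n)" for N
  proof -
    have c: "mscale (?c j) x = of_nat (Suc n choose j) * (- ?B) ^ (Suc n - j) * x" for j x
      by (simp only: neg_B mscale_one_power mscale_mult_left mscale_mult_right mult_1 mult.assoc
          mfps.scale_scale[symmetric] mscale_of_nat[symmetric]) (rule mfps.scale_left_commute)
    have "(\<Sum>i<N. log_deriv i $ n) = (\<Sum>i<N. \<Sum>j\<le>Suc n. of_nat (Suc n choose j) * (- ?B) ^ (Suc n - j) *
        (if odd j then 2 * ((var i + ?B) ^ j - ?B ^ j) else 0))"
      by (rule sum.cong) (simp_all only: log_deriv_def fps_nth_Abs_fps two_B odd_part_expansion[OF zero_less_Suc])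
    also have "\<dots> = (\<Sum>j\<le>Suc n. \<Sum>i<N. of_nat (Suc n choose j) * (- ?B) ^ (Suc n - j) *
        (if odd j then 2 * ((var i + ?B) ^ j - ?B ^ j) else 0))"
      by (rule sum.swap)
    also have "\<dots> = (\<Sum>j\<le>Suc n. mscale (?c j) (if odd j then mscale 2 (?s j N) else 0))"
    proof (rule sum.cong[OF refl])
      fix j
      show "(\<Sum>i<N. of_nat (Suc n choose j) * (- ?B) ^ (Suc n - j) *
          (if odd j then 2 * ((var i + ?B) ^ j - ?B ^ j) else 0)) =
          mscale (?c j) (if odd j then mscale 2 (?s j N) else 0)"
        unfolding c two[symmetric] by (cases "odd j") (simp_all only: not_False_eq_True if_True if_False sum_distrib_left mult_zero_right sum.neutral_const)
    qed
    finally show ?thesis ..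
  qed
  ultimately show ?thesis by simp
qed

text \<open>Coefficients are compared in the differential equation of the finite partial products,
  and the limit is taken afterwards.\<close>

lemma q_beta_newton: "of_nat n * q_beta n = (\<Sum>k<n. q_newton_coeff (n - k) * q_beta k)"
proof (cases n)
  case (Suc m)
  let ?Q = "\<lambda>N. \<Prod>i<N. Q_factor i"
  have "coeff_limit (\<lambda>N. of_nat (Suc m) * ?Q N $ Suc m) (of_nat (Suc m) * q_beta (Suc m))"
    unfolding mscale_of_nat[symmetric] by (intro coeff_limit_mscale coeff_limit_q_beta)
  moreover have "of_nat (Suc m) * ?Q N $ Suc m = (\<Sum>k=0..m. ?Q N $ k * (\<Sum>i<N. log_deriv i $ (m - k)))" for N
  proof -
    have "of_nat (Suc m) * ?Q N $ Suc m = fps_deriv (?Q N) $ m" by simp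
    also have "\<dots> = (\<Sum>k=0..m. ?Q N $ k * (\<Sum>i<N. log_deriv i) $ (m - k))"
      by (simp only: fps_deriv_prod_Q_factor fps_mult_nth)
    finally show ?thesis by (simp only: fps_sum_nth)
  qed
  moreover have "coeff_limit (\<lambda>N. \<Sum>k=0..m. ?Q N $ k * (\<Sum>i<N. log_deriv i $ (m - k)))
      (\<Sum>k=0..m. q_beta k * q_newton_coeff (Suc (m - k)))"
    by (intro coeff_limit_sum coeff_limit_mult coeff_limit_q_beta coeff_limit_log_deriv)
  ultimately have "of_nat (Suc m) * q_beta (Suc m) = (\<Sum>k=0..m. q_beta k * q_newton_coeff (Suc (m - k)))"
    by (intro coeff_limit_unique) simp_all
  also have "\<dots> = (\<Sum>k<Suc m. q_newton_coeff (Suc m - k) * q_beta k)"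
    by (rule sum.cong) (auto simp: Suc_diff_le mult.commute)
  finally show ?thesis by (simp only: Suc)
qed simp

lemma q_newton_coeff_leading: "q_newton_coeff k - newton_coeff k \<in> W k"
proof -
  have "q_newton_coeff k - newton_coeff k =
      (\<Sum>j<k. mscale (of_nat (k choose j) * (- (\<beta> / 2)) ^ (k - j)) (newton_coeff j))"
    by (simp add: q_newton_coeff_def lessThan_Suc_atMost[symmetric])
  also have "\<dots> \<in> W k"
    by (intro level_sum level_scale level_monoD[OF newton_coeff_in_W]) simp
  finally show ?thesis .
qed

lemma q_newton_coeff_in_W: "q_newton_coeff k \<in> W (Suc k)"
proof -
  have "q_newton_coeff k - newton_coeff k \<in> W (Suc k)"
    using q_newton_coeff_leading by (rule level_monoD) simp
  from level_add[OF this newton_coeff_in_W] show ?thesis by simp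
qed

text \<open>Both sequences satisfy Newton identities of the same form, whose coefficients agree
  modulo smaller sizes.\<close>

lemma q_beta_leading: "q_beta n - schur_q n \<in> W n"
proof (induction n rule: less_induct)
  case (less n)
  show ?case
  proof (cases n)
    case 0
    then show ?thesis by (simp add: q_beta_0 level_zero)
  next
    case (Suc m)
    have "of_nat n * (q_beta n - schur_q n) =
        (\<Sum>k<n. q_newton_coeff (n - k) * q_beta k - newton_coeff (n - k) * schur_q k)"
      by (simp only: right_diff_distrib q_beta_newton schur_q_newton sum_subtractf)
    also have "\<dots> = (\<Sum>k<n. q_newton_coeff (n - k) * (q_beta k - schur_q k) +
        schur_q k * (q_newton_coeff (n - k) - newton_coeff (n - k)))"
      by (rule sum.cong) (simp_all add: algebra_simps)
    also have "\<dots> \<in> W n"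
    proof (rule level_sum)
      fix k assume k: "k \<in> {..<n}"
      have "q_newton_coeff (n - k) * (q_beta k - schur_q k) \<in> W (n - k + k)"
        using k by (intro level_mult[OF add_closed_OP q_newton_coeff_in_W less.IH]) simp
      moreover have "schur_q k * (q_newton_coeff (n - k) - newton_coeff (n - k)) \<in> W (k + (n - k))"
        by (rule level_mult[OF add_closed_OP schur_q_in_W q_newton_coeff_leading])
      ultimately show "q_newton_coeff (n - k) * (q_beta k - schur_q k) +
          schur_q k * (q_newton_coeff (n - k) - newton_coeff (n - k)) \<in> W n"
        using k by (intro level_add) simp_all
    qed
    finally show ?thesis
      unfolding Suc by (rule level_of_nat_mult)
  qed
qed

lemma schur_like_q_beta: "schur_like (\<lambda>_. 1) q_beta"
  using q_beta_leading by (simp add: schur_like_def)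

text \<open>\<open>zbar\<close> involves no variables, so composition with it forms linear
  combinations of the \<open>q_beta k\<close> over the ground field.\<close>

lemma zbar_power_scalar: "\<exists>c. zbar ^ i $ n = mscale c 1"
proof (induction i arbitrary: n)
  case 0
  have "zbar ^ 0 $ n = mscale (if n = 0 then 1 else 0) 1" by simp
  then show ?case by blast
next
  case (Suc i)
  have "\<exists>c. zbar $ k = mscale c 1" for k
  proof (cases k)
    case 0
    then have "zbar $ k = mscale 0 1" by (simp add: zbar_geometric)
    then show ?thesis by blast
  next
    case (Suc l)
    have neg: "- beta_const = mscale (- \<beta>) 1"
      by (rule mfps_eqI) (simp add: mcoeff_mscale mcoeff_uminus)
    have "zbar $ k = - ((- beta_const) ^ l)"
      by (simp add: zbar_geometric Suc geometric_def)
    also have "\<dots> = - mscale ((- \<beta>) ^ l) 1"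
      by (simp only: neg mscale_one_power)
    also have "\<dots> = mscale (- ((- \<beta>) ^ l)) 1" by simp
    finally show ?thesis by blast
  qed
  then obtain c where c: "\<And>k. zbar $ k = mscale (c k) 1" by metis
  obtain d where d: "\<And>k. zbar ^ i $ k = mscale (d k) 1" using Suc.IH by metis
  have "zbar ^ Suc i $ n = (\<Sum>k=0..n. mscale (c k * d (n - k)) 1)"
    by (simp add: fps_mult_nth c d mscale_one_mult)
  also have "\<dots> = mscale (\<Sum>k=0..n. c k * d (n - k)) 1"
    by (rule mfps.scale_sum_left[symmetric])
  finally show ?case by blast
qed

text \<open>As \<open>zbar\<close> starts with \<open>- z\<close>, its \<open>n\<close>-th power
  starts with \<open>(-1)^n z^n\<close>: the conjugate is \<open>(-1)^n * q_beta n\<close> plus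
  scalar multiples of \<open>q_beta k\<close> with \<open>k < n\<close>.\<close>

lemma schur_like_qbar_beta: "schur_like (\<lambda>n. (- 1) ^ n) qbar_beta"
  unfolding schur_like_def
proof (intro allI impI conjI)
  fix n :: nat
  have q_W: "q_beta k \<in> W (Suc k)" for k
    using level_add[OF level_monoD[OF q_beta_leading[of k]] schur_q_in_W[of k]] by simp
  have "zbar $ 0 = 0" by (simp add: zbar_geometric)
  then have "zbar ^ n $ n = (zbar $ 1) ^ n" by (rule startsby_zero_power_nth_same)
  also have "zbar $ 1 = mscale (- 1) 1" by (simp add: zbar_geometric geometric_def)
  finally have top: "zbar ^ n $ n = mscale ((- 1) ^ n) 1" by (simp only: mscale_one_power)
  have "qbar_beta n = (\<Sum>k=0..n. q_beta k * zbar ^ k $ n)"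
    by (simp add: qbar_beta_def fps_compose_nth q_beta_def)
  also have "\<dots> = (\<Sum>k<n. q_beta k * zbar ^ k $ n) + q_beta n * zbar ^ n $ n"
    by (simp add: atLeast0AtMost lessThan_Suc_atMost[symmetric])
  finally have eq: "qbar_beta n - mscale ((- 1) ^ n) (schur_q n) =
      (\<Sum>k<n. q_beta k * zbar ^ k $ n) + mscale ((- 1) ^ n) (q_beta n - schur_q n)"
    by (simp only: top mscale_mult_right mult_1_right mfps.scale_right_diff_distrib) simp
  show "qbar_beta n - mscale ((- 1) ^ n) (schur_q n) \<in> W n"
    unfolding eq
  proof (intro level_add level_sum level_scale q_beta_leading)
    fix k assume "k \<in> {..<n}"
    moreover obtain c where "zbar ^ k $ n = mscale c 1" using zbar_power_scalar by blast
    ultimately show "q_beta k * zbar ^ k $ n \<in> W n"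
      using level_scale[OF level_monoD[OF q_W[of k]], of n c] by (simp add: mscale_mult_right)
  qed
qed simp

theorem theorem3p4:
  shows "is_basis_family (prod_parts p_beta) \<O>\<P> g\<Gamma> \<and>
         is_basis_family (prod_parts q_beta) \<O>\<P> g\<Gamma> \<and>
         is_basis_family (prod_parts qbar_beta) \<O>\<P> g\<Gamma> \<and>
         is_basis_family (prod_parts q_beta) \<S>\<P> g\<Gamma> \<and>
         is_basis_family (prod_parts qbar_beta) \<S>\<P> g\<Gamma>"
  using schur_like_bases[OF schur_like_q_beta] schur_like_bases[OF schur_like_qbar_beta]
    prod_p_beta_independent span_prod_p_beta
  by (simp add: is_basis_family_def)

end
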